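(* Let $S=\begin{bmatrix}I_{Z_h}&0\\ 0&-I_{U^*}\end{bmatrix}M\begin{bmatrix}\mathcal R_{Z_h}Q&0\\ 0&I_U\end{bmatrix}$, with $M=\begin{bmatrix}F\&G\\ K\&L\end{bmatrix}$, be a port-Hamiltonian $E$-operator node on $(X_h,U,Z_h,U^* )$, and let $\tilde H=\mathcal R_{Z_h}$. a) If $Q$ is invertible and $\mathrm{ran}\,E$ is closed, then $\{\lambda\in\mathbb{C}:\mathrm{Re}\,\lambda>0\}\subseteq\rho(E,F\tilde HQ)$. In this case $S$ is a port-Hamiltonian $E$-system node and the complex resolvent index of $(E,F\tilde HQ)$ is at most $3$. b) All generalized trajectories $(x,u,y)$ (and thus also classical trajectories) of $$\begin{bmatrix}\frac{\mathrm d}{\mathrm dt}E&0\\ 0&I_{U^*}\end{bmatrix}\begin{pmatrix}x(t)\\ y(t)\end{pmatrix}=S\begin{pmatrix}x(t)\\ u(t)\end{pmatrix}=\begin{bmatrix}F\&G\\ -(K\&L)\end{bmatrix}\begin{bmatrix}\tilde HQ&0\\ 0&I_U\end{bmatrix}\begin{pmatrix}x(t)\\ u(t)\end{pmatrix}\qquad( ** )$$ satisfy the dissipation inequality $$\mathcal H(x(t))-\mathcal H(x(0))\le\mathrm{Re}\int_0^t\langle y(\tau),u(\tau)\rangle_{U^*,U}\,\mathrm d\tau,\qquad t\ge0,$$ where $\mathcal H$ is the Hamiltonian of $S$.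
   Context: $X,Z,U$ are complex Hilbert spaces; $(\cdot)^*$ denotes the anti-dual. Quasi Gelfand triples: for a densely defined, positive ($h(x,x)>0$ for $x\ne0$), closed sesquilinear form $h$ on a Hilbert space $X$ with domain $\mathrm{dom}(h)$, $X_h$ is the completion of $\mathrm{dom}(h)$ with respect to $\|x\|_h=h(x,x)^{1/2}$ (the form $h$ extends to the inner product of $X_h$), and $X_{h-}$ is the completion of $\{x'\in X:\|x'\|_{h-}<\infty\}$ with $\|x'\|_{h-}=\sup_{x\in\mathrm{dom}(h)\setminus\{0\}}|\langle x',x\rangle_X|/\|x\|_h$; it is identified with $X_h^*$. $(X_h^*,X,X_h)$ is the quasi Gelfand triple associated with $h$. Here $(X_h^*,X,X_h)$ and $(Z_h^*,Z,Z_h)$ are quasi Gelfand triples associated with forms $h_X$ on $X$ and $h_Z$ on $Z$. $\tilde H=\mathcal R_{Z_h}\colon Z_h\to Z_h^*$ is the Riesz isomorphism, $\langle\mathcal R_{Z_h}z,w\rangle_{Z_h^*,Z_h}=h_Z(z,w)$. Operator nodes: let $\mathcal X,\mathcal U,\mathcal Z,\mathcal Y$ be Hilbert spaces, $T\colon\mathrm{dom}(T)\subseteq\mathcal X\times\mathcal U\to\mathcal Z\times\mathcal Y$ linear, with components $P_{\mathcal Z}T$, $P_{\mathcal Y}T$ on $\mathrm{dom}(T)$ and main operator $ax=P_{\mathcal Z}T\begin{pmatrix}x\\ 0\end{pmatrix}$, $\mathrm{dom}(a)=\{x:\begin{pmatrix}x\\ 0\end{pmatrix}\in\mathrm{dom}(T)\}$.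 For $e\colon\mathcal X\to\mathcal Z$ linear, $T$ is an $e$-operator node on $(\mathcal X,\mathcal U,\mathcal Z,\mathcal Y)$ if $T$ is closed, $e$ is bounded, $P_{\mathcal Z}T$ with domain $\mathrm{dom}(T)$ is closed, $\rho(e,a)\neq\emptyset$, $\mathrm{dom}(a)$ is dense in $\mathcal X$, and for all $u\in\mathcal U$ there is $x\in\mathcal X$ with $\begin{pmatrix}x\\ u\end{pmatrix}\in\mathrm{dom}(T)$. Here $\rho(e,a)$ is the set of $\lambda\in\mathbb{C}$ such that $\lambda e-a\colon\mathrm{dom}(a)\to\mathcal Z$ has a bounded inverse defined on all of $\mathcal Z$. It is an $e$-system node if in addition there are $p\in\mathbb{N}_0$, $M_0>0$, $\omega\in\mathbb{R}$ with $\{\mathrm{Re}\,\lambda\ge\omega\}\subseteq\rho(e,a)$ and $\|(\lambda e-a)^{-1}\|\le M_0(1+|\lambda|^{p-1})$ there. The complex resolvent index of $(e,a)$ is the smallest $p\in\mathbb{N}_0$ for which there are $\omega\in\mathbb{R}$, $C>0$ with $\{\mathrm{Re}\,\lambda>\omega\}\subseteq\rho(e,a)$ and $\|(\lambda e-a)^{-1}\|\le C|\lambda|^{p-1}$ for $\mathrm{Re}\,\lambda>\omega$. Dissipation node: $M=\begin{bmatrix}F\&G\\ K\&L\end{bmatrix}\colon\mathrm{dom}(M)\subseteq Z_h^*\times U\to Z_h\times U^*$ with main operator $F$ is a dissipation node on $(Z_h^*,U,Z_h,U^* )$ if it is an $\mathcal R_{Z_h}^{-1}$-operator node on $(Z_h^*,U,Z_h,U^*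 )$, it is dissipative, i.e. $\mathrm{Re}\,\langle v,Mv\rangle_{Z_h^*\times U,\,Z_h\times U^*}\le0$ for all $v\in\mathrm{dom}(M)$, and $\rho(\mathcal R_{Z_h}^{-1},F)\cap\{\mathrm{Re}\,\lambda>0\}\ne\emptyset$. Port-Hamiltonian node: let $E,Q\in L(X_h,Z_h)$ and let $M$ be a dissipation node on $(Z_h^*,U,Z_h,U^* )$. Then $S=\begin{bmatrix}I_{Z_h}&0\\ 0&-I_{U^*}\end{bmatrix}M\begin{bmatrix}\tilde HQ&0\\ 0&I_U\end{bmatrix}$ (with its natural domain) is a port-Hamiltonian $E$-operator node on $(X_h,U,Z_h,U^* )$ if $h_Z(Qx,Ex)\ge0$ for all $x\in X_h$ and $\rho(E,F\tilde HQ)\cap\{\mathrm{Re}\,\lambda>0\}\neq\emptyset$, where $\mathrm{dom}(F\tilde HQ)=\{x\in X_h:\tilde HQx\in\mathrm{dom}(F)\}$. If $S$ is additionally an $E$-system node, it is called a port-Hamiltonian $E$-system node. Its Hamiltonian is $\mathcal H\colon X_h\to\mathbb{R}$, $\mathcal H(x)=\tfrac12h_Z(Qx,Ex)=\tfrac12\langle\tilde HQx,Ex\rangle_{Z_h^*,Z_h}$. Trajectories: a classical trajectory of $( ** )$ is $(x,u,Ex,y)\in C([0,\infty);X_h)\times C([0,\infty);U)\times C^1([0,\infty);Z_h)\times C([0,\infty);U^* )$ satisfying $( ** )$ for all $t\ge0$. A generalized trajectory is an element of $C([0,\infty);X_h)\times L^2([0,\infty);U)\times C([0,\infty);Z_h)\times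 L^2([0,\infty);U^* )$ which is a limit of classical trajectories in the topology of this space (with uniform convergence on compact intervals for the continuous components). Trajectories are abbreviated $(x,u,y)$. *)

theory Defs
  imports "HOL-Analysis.Analysis" "HOL-Library.Extended_Nat"
begin

section \<open>Complex normed spaces and complex Hilbert spaces\<close>

class complex_vector = real_vector +
  fixes scaleC :: "complex \<Rightarrow> 'a \<Rightarrow> 'a"  (infixr "*\<^sub>C" 75)
  assumes scaleC_add_right: "c *\<^sub>C (x + y) = c *\<^sub>C x + c *\<^sub>C y"
    and scaleC_add_left: "(c + d) *\<^sub>C x = c *\<^sub>C x + d *\<^sub>C x"
    and scaleC_scaleC: "c *\<^sub>C d *\<^sub>C x = (c * d) *\<^sub>C x"
    and scaleR_eq_scaleC: "r *\<^sub>R x = complex_of_real r *\<^sub>C x"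

class complex_normed_vector = complex_vector + real_normed_vector +
  assumes norm_scaleC: "norm (c *\<^sub>C x) = cmod c * norm x"

text \<open>Inner products are linear in the first and antilinear in the second argument.\<close>

class chilbert_space = complex_normed_vector + banach +
  fixes cinner :: "'a \<Rightarrow> 'a \<Rightarrow> complex"
  assumes cinner_commute: "cinner x y = cnj (cinner y x)"
    and cinner_add_left: "cinner (x + y) z = cinner x z + cinner y z"
    and cinner_scaleC_left: "cinner (c *\<^sub>C x) y = c * cinner x y"
    and cinner_self: "cinner x x = complex_of_real ((norm x)\<^sup>2)"

lemma cinner_add_right: "cinner x (y + z) = cinner x y + cinner x (z::'a::chilbert_space)"
  by (metis cinner_add_left cinner_commute complex_cnj_add)

lemma cinner_scaleC_right: "cinner x (c *\<^sub>C y) = cnj c * cinner x (y::'a::chilbert_space)"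
  by (metis cinner_scaleC_left cinner_commute complex_cnj_mult)

lemma cinner_Cauchy_Schwarz: "cmod (cinner x y) \<le> norm x * norm (y::'a::chilbert_space)"
proof (cases "y = 0")
  case True
  then have "y + y = y" by simp
  then have "cinner x y = 0" using cinner_add_right[of x y y] by simp
  then show ?thesis by simp
next
  case False
  define n where "n = complex_of_real ((norm y)\<^sup>2)"
  define c where "c = cinner x y"
  define z where "z = n *\<^sub>C x + (- c) *\<^sub>C y"
  have yx: "cinner y x = cnj c" and nc: "cnj n = n"
    unfolding c_def n_def using cinner_commute by auto
  have yy: "cinner y y = n" unfolding n_def by (rule cinner_self)
  have "cinner z z = n * (n * cinner x x) - n * (c * cnj c)"
    unfolding z_def
    by (simp add: cinner_add_left cinner_add_right cinner_scaleC_left cinner_scaleC_right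
        yx nc c_def[symmetric] yy algebra_simps)
  also have "\<dots> = complex_of_real ((norm y)\<^sup>2 * ((norm y)\<^sup>2 * (norm x)\<^sup>2 - (cmod c)\<^sup>2))"
    by (simp add: cinner_self n_def complex_norm_square[symmetric] algebra_simps)
  finally have "complex_of_real ((norm z)\<^sup>2) =
      complex_of_real ((norm y)\<^sup>2 * ((norm y)\<^sup>2 * (norm x)\<^sup>2 - (cmod c)\<^sup>2))"
    by (simp add: cinner_self)
  then have "(norm z)\<^sup>2 = (norm y)\<^sup>2 * ((norm y)\<^sup>2 * (norm x)\<^sup>2 - (cmod c)\<^sup>2)"
    using of_real_eq_iff by blast
  then have "0 \<le> (norm y)\<^sup>2 * ((norm y)\<^sup>2 * (norm x)\<^sup>2 - (cmod c)\<^sup>2)"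
    by (metis zero_le_power2)
  with False have "(cmod c)\<^sup>2 \<le> (norm x * norm y)\<^sup>2"
    by (simp add: zero_le_mult_iff power_mult_distrib mult.commute)
  then show ?thesis unfolding c_def by (rule power2_le_imp_le) simp
qed

instantiation prod :: (complex_vector, complex_vector) complex_vector
begin

definition scaleC_prod :: "complex \<Rightarrow> 'a \<times> 'b \<Rightarrow> 'a \<times> 'b"
  where "scaleC_prod c p = (c *\<^sub>C fst p, c *\<^sub>C snd p)"

instance
  by standard
    (auto simp: scaleC_prod_def scaleC_add_right scaleC_add_left scaleC_scaleC
      scaleR_eq_scaleC prod_eq_iff)

end

instance prod :: (complex_normed_vector, complex_normed_vector) complex_normed_vector
proof
  fix c :: complex and p :: "'a \<times> 'b"
  show "norm (c *\<^sub>C p) = cmod c * norm p"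
    by (simp add: scaleC_prod_def norm_prod_def norm_scaleC power_mult_distrib
        distrib_left[symmetric] real_sqrt_mult)
qed

definition csubspace :: "'a::complex_vector set \<Rightarrow> bool" where
  "csubspace D \<longleftrightarrow> 0 \<in> D \<and> (\<forall>x\<in>D. \<forall>y\<in>D. x + y \<in> D) \<and> (\<forall>c. \<forall>x\<in>D. c *\<^sub>C x \<in> D)"

definition clinear_on :: "'a::complex_vector set \<Rightarrow> ('a \<Rightarrow> 'b::complex_vector) \<Rightarrow> bool" where
  "clinear_on D f \<longleftrightarrow> (\<forall>x\<in>D. \<forall>y\<in>D. f (x + y) = f x + f y) \<and> (\<forall>c. \<forall>x\<in>D. f (c *\<^sub>C x) = c *\<^sub>C f x)"

definition bounded_clinear :: "('a::complex_normed_vector \<Rightarrow> 'b::complex_normed_vector) \<Rightarrow> bool" where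
  "bounded_clinear f \<longleftrightarrow> bounded_linear f \<and> (\<forall>c x. f (c *\<^sub>C x) = c *\<^sub>C f x)"

definition invertible_clinear :: "('a::complex_normed_vector \<Rightarrow> 'b::complex_normed_vector) \<Rightarrow> bool" where
  "invertible_clinear f \<longleftrightarrow> (\<exists>g. bounded_clinear g \<and> g \<circ> f = id \<and> f \<circ> g = id)"


section \<open>The anti-dual\<close>

definition bounded_antilinear :: "('a::complex_normed_vector \<Rightarrow> complex) \<Rightarrow> bool" where
  "bounded_antilinear f \<longleftrightarrow> bounded_linear f \<and> (\<forall>c x. f (c *\<^sub>C x) = cnj c * f x)"

typedef (overloaded) ('a::complex_normed_vector) antidual = "{f::'a \<Rightarrow> complex. bounded_antilinear f}"
  morphisms antidual_apply Antidual
  by (rule exI[of _ "\<lambda>_. 0"]) (simp add: bounded_antilinear_def)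

setup_lifting type_definition_antidual

instantiation antidual :: (complex_normed_vector) complex_normed_vector
begin

lift_definition norm_antidual :: "'a antidual \<Rightarrow> real" is onorm .

lift_definition minus_antidual :: "'a antidual \<Rightarrow> 'a antidual \<Rightarrow> 'a antidual"
  is "\<lambda>f g x. f x - g x"
  by (simp add: bounded_antilinear_def bounded_linear_sub algebra_simps)

definition dist_antidual :: "'a antidual \<Rightarrow> 'a antidual \<Rightarrow> real"
  where "dist_antidual a b = norm (a - b)"

definition uniformity_antidual :: "('a antidual \<times> 'a antidual) filter"
  where "uniformity_antidual = (INF e\<in>{0 <..}. principal {(x, y). dist x y < e})"

definition open_antidual :: "'a antidual set \<Rightarrow> bool"
  where "open_antidual S = (\<forall>x\<in>S. \<forall>\<^sub>F (x', y) in uniformity. x' = x \<longrightarrow> y \<in> S)"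

lift_definition uminus_antidual :: "'a antidual \<Rightarrow> 'a antidual" is "\<lambda>f x. - f x"
  by (simp add: bounded_antilinear_def bounded_linear_minus)

lift_definition zero_antidual :: "'a antidual" is "\<lambda>x. 0"
  by (simp add: bounded_antilinear_def)

lift_definition plus_antidual :: "'a antidual \<Rightarrow> 'a antidual \<Rightarrow> 'a antidual"
  is "\<lambda>f g x. f x + g x"
  by (simp add: bounded_antilinear_def bounded_linear_add algebra_simps)

lift_definition scaleR_antidual :: "real \<Rightarrow> 'a antidual \<Rightarrow> 'a antidual"
  is "\<lambda>r f x. r *\<^sub>R f x"
  by (simp add: bounded_antilinear_def bounded_linear_const_scaleR)

lift_definition scaleC_antidual :: "complex \<Rightarrow> 'a antidual \<Rightarrow> 'a antidual"
  is "\<lambda>c f x. c * f x"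
  by (simp add: bounded_antilinear_def bounded_linear_const_mult)

definition sgn_antidual :: "'a antidual \<Rightarrow> 'a antidual"
  where "sgn_antidual x = scaleR (inverse (norm x)) x"

instance
proof
  fix f g h :: "'a antidual" and r s :: real and c d :: complex
  show "f + g + h = f + (g + h)" "f + g = g + f" "0 + f = f" "- f + f = 0" "f - g = f + - g"
    by (transfer, force)+
  show "r *\<^sub>R (f + g) = r *\<^sub>R f + r *\<^sub>R g" "(r + s) *\<^sub>R f = r *\<^sub>R f + s *\<^sub>R f"
    "r *\<^sub>R s *\<^sub>R f = (r * s) *\<^sub>R f" "1 *\<^sub>R f = f"
    by (transfer, force simp: algebra_simps)+
  show "c *\<^sub>C (f + g) = c *\<^sub>C f + c *\<^sub>C g" "(c + d) *\<^sub>C f = c *\<^sub>C f + d *\<^sub>C f"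
    "c *\<^sub>C d *\<^sub>C f = (c * d) *\<^sub>C f"
    by (transfer, force simp: algebra_simps)+
  show "r *\<^sub>R f = complex_of_real r *\<^sub>C f"
    by (transfer, force simp: scaleR_conv_of_real)
  show "dist f g = norm (f - g)" by (simp add: dist_antidual_def)
  show "sgn f = inverse (norm f) *\<^sub>R f" by (simp add: sgn_antidual_def)
  show "uniformity = (INF e\<in>{0 <..}. principal {(x, y::'a antidual). dist x y < e})"
    by (simp add: uniformity_antidual_def)
  show "open S = (\<forall>x\<in>S. \<forall>\<^sub>F (x', y) in uniformity. x' = x \<longrightarrow> y \<in> S)" for S :: "'a antidual set"
    by (simp add: open_antidual_def)
  show "norm f = 0 \<longleftrightarrow> f = 0"
    by transfer (auto simp: bounded_antilinear_def onorm_eq_0)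
  show "norm (f + g) \<le> norm f + norm g"
    by transfer (auto simp: bounded_antilinear_def onorm_triangle)
  show "norm (r *\<^sub>R f) = \<bar>r\<bar> * norm f"
    by transfer (auto simp: bounded_antilinear_def onorm_scaleR)
  show "norm (c *\<^sub>C f) = cmod c * norm f"
  proof transfer
    fix c :: complex and f :: "'a \<Rightarrow> complex"
    assume "bounded_antilinear f"
    then have bl: "bounded_linear f" by (simp add: bounded_antilinear_def)
    have *: "onorm (\<lambda>x. c * f x) \<le> cmod c * onorm f"
      if "bounded_linear f" for c and f :: "'a \<Rightarrow> complex"
    proof (rule onorm_bound)
      show "0 \<le> cmod c * onorm f" by (simp add: onorm_pos_le[OF that])
      show "norm (c * f x) \<le> cmod c * onorm f * norm x" for x
        unfolding norm_mult mult.assoc by (rule mult_left_mono[OF onorm[OF that]]) simp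
    qed
    show "onorm (\<lambda>x. c * f x) = cmod c * onorm f"
    proof (cases "c = 0")
      case True
      then show ?thesis by (simp add: onorm_zero)
    next
      case False
      have "onorm (\<lambda>x. inverse c * (c * f x)) \<le> cmod (inverse c) * onorm (\<lambda>x. c * f x)"
        by (rule *) (rule bounded_linear_const_mult[OF bl])
      moreover have "(\<lambda>x. inverse c * (c * f x)) = f"
        using False by (simp add: fun_eq_iff)
      ultimately have "onorm f \<le> onorm (\<lambda>x. c * f x) / cmod c"
        by (simp add: norm_inverse divide_inverse mult.commute)
      then have "cmod c * onorm f \<le> onorm (\<lambda>x. c * f x)"
        using False by (simp add: pos_le_divide_eq mult.commute)
      then show ?thesis using *[OF bl, of c] by simp
    qed
  qed
qed

end

lemma norm_antidual_apply: "cmod (antidual_apply f x) \<le> norm f * norm x"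
  by transfer (auto simp: bounded_antilinear_def onorm)

lemma norm_antidual_bound:
  "0 \<le> b \<Longrightarrow> (\<And>x. cmod (antidual_apply f x) \<le> b * norm x) \<Longrightarrow> norm f \<le> b"
  by transfer (rule onorm_bound)

instance antidual :: (complex_normed_vector) banach
proof
  fix X :: "nat \<Rightarrow> 'a antidual"
  assume X: "Cauchy X"
  define F where "F n = Blinfun (antidual_apply (X n))" for n
  have bl: "bounded_linear (antidual_apply f)"
    and al: "antidual_apply f (c *\<^sub>C x) = cnj c * antidual_apply f x" for f :: "'a antidual" and c x
    using antidual_apply[of f] by (auto simp: bounded_antilinear_def)
  have F: "blinfun_apply (F n) = antidual_apply (X n)" for n
    unfolding F_def using bl by (rule bounded_linear_Blinfun_apply)
  have "dist (F m) (F n) \<le> dist (X m) (X n)" for m n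
  proof -
    have "norm (blinfun_apply (F m - F n) x) \<le> norm (X m - X n) * norm x" for x
      using norm_antidual_apply[of "X m - X n" x]
      by (simp add: blinfun.diff_left F minus_antidual.rep_eq)
    then show ?thesis by (simp add: dist_norm norm_blinfun_bound)
  qed
  then have "Cauchy F"
    using X unfolding Cauchy_def by (meson le_less_trans)
  then obtain G where G: "F \<longlonglongrightarrow> G"
    using Cauchy_convergent convergent_def by blast
  have lim: "(\<lambda>n. antidual_apply (X n) x) \<longlonglongrightarrow> blinfun_apply G x" for x
    using blinfun.tendsto[OF G tendsto_const, of x] by (simp add: F)
  have "blinfun_apply G (c *\<^sub>C x) = cnj c * blinfun_apply G x" for c x
    using LIMSEQ_unique[OF lim[of "c *\<^sub>C x"]] tendsto_mult[OF tendsto_const lim[of x], of "cnj c"]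
    by (simp add: al)
  then have g: "antidual_apply (Antidual (blinfun_apply G)) = blinfun_apply G"
    by (intro Antidual_inverse) (simp add: bounded_antilinear_def blinfun.bounded_linear_right)
  have "dist (X n) (Antidual (blinfun_apply G)) \<le> dist (F n) G" for n
    unfolding dist_norm
  proof (rule norm_antidual_bound)
    show "cmod (antidual_apply (X n - Antidual (blinfun_apply G)) x) \<le> norm (F n - G) * norm x" for x
      using norm_blinfun[of "F n - G" x] by (simp add: blinfun.diff_left F minus_antidual.rep_eq g)
  qed simp
  moreover have "(\<lambda>n. dist (F n) G) \<longlonglongrightarrow> 0"
    using G by (simp add: tendsto_dist_iff[symmetric])
  ultimately have "(\<lambda>n. dist (X n) (Antidual (blinfun_apply G))) \<longlonglongrightarrow> 0"
    by - (rule Lim_null_comparison[OF always_eventually], auto)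
  then have "X \<longlonglongrightarrow> Antidual (blinfun_apply G)"
    by (rule iffD2[OF tendsto_dist_iff])
  then show "convergent X" by (rule convergentI)
qed

text \<open>The Riesz isomorphism \<open>\<R> z = \<langle>z, \<cdot>\<rangle>\<close> onto the anti-dual.\<close>

lift_definition riesz :: "'a::chilbert_space \<Rightarrow> 'a antidual" is cinner
proof -
  fix z :: 'a
  show "bounded_antilinear (cinner z)"
    unfolding bounded_antilinear_def
  proof (intro conjI allI bounded_linear_intro)
    show "cinner z (x + y) = cinner z x + cinner z y" for x y by (rule cinner_add_right)
    show "cinner z (r *\<^sub>R x) = r *\<^sub>R cinner z x" for r x
      by (simp add: scaleR_eq_scaleC cinner_scaleC_right scaleR_conv_of_real)
    show "norm (cinner z x) \<le> norm x * norm z" for x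
      using cinner_Cauchy_Schwarz[of z x] by (simp add: mult.commute)
    show "cinner z (c *\<^sub>C x) = cnj c * cinner z x" for c x by (rule cinner_scaleC_right)
  qed
qed


section \<open>Quasi Gelfand triples\<close>

definition sesquilinear_on :: "'a::complex_vector set \<Rightarrow> ('a \<Rightarrow> 'a \<Rightarrow> complex) \<Rightarrow> bool" where
  "sesquilinear_on D h \<longleftrightarrow> csubspace D \<and>
     (\<forall>x\<in>D. \<forall>y\<in>D. \<forall>z\<in>D. h (x + y) z = h x z + h y z \<and> h z (x + y) = h z x + h z y) \<and>
     (\<forall>c. \<forall>x\<in>D. \<forall>y\<in>D. h (c *\<^sub>C x) y = c * h x y \<and> h x (c *\<^sub>C y) = cnj c * h x y)"

definition form_norm :: "('a \<Rightarrow> 'a \<Rightarrow> complex) \<Rightarrow> 'a \<Rightarrow> real" where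
  "form_norm h x = sqrt (Re (h x x))"

definition closed_form :: "'a::complex_normed_vector set \<Rightarrow> ('a \<Rightarrow> 'a \<Rightarrow> complex) \<Rightarrow> bool" where
  "closed_form D h \<longleftrightarrow>
     (\<forall>s x. (\<forall>n. s n \<in> D) \<and> s \<longlonglongrightarrow> x \<and>
        (\<forall>e>0. \<exists>N. \<forall>m\<ge>N. \<forall>n\<ge>N. form_norm h (s m - s n) < e) \<longrightarrow>
        x \<in> D \<and> (\<lambda>n. form_norm h (s n - x)) \<longlonglongrightarrow> 0)"

definition gelfand_form :: "'a::chilbert_space set \<Rightarrow> ('a \<Rightarrow> 'a \<Rightarrow> complex) \<Rightarrow> bool" where
  "gelfand_form D h \<longleftrightarrow> sesquilinear_on D h \<and> closure D = UNIV \<and>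
     (\<forall>x\<in>D. x \<noteq> 0 \<longrightarrow> h x x \<in> \<real> \<and> 0 < Re (h x x)) \<and> closed_form D h"

definition dual_form_norm ::
  "'a::chilbert_space set \<Rightarrow> ('a \<Rightarrow> 'a \<Rightarrow> complex) \<Rightarrow> 'a \<Rightarrow> ennreal" where
  "dual_form_norm D h x' = (SUP x\<in>D - {0}. ennreal (cmod (cinner x' x) / form_norm h x))"

definition dual_form_dom :: "'a::chilbert_space set \<Rightarrow> ('a \<Rightarrow> 'a \<Rightarrow> complex) \<Rightarrow> 'a set" where
  "dual_form_dom D h = {x'. dual_form_norm D h x' < \<infinity>}"

definition completion_of ::
  "'a::complex_vector set \<Rightarrow> ('a \<Rightarrow> real) \<Rightarrow> ('a \<Rightarrow> 'b::{complex_normed_vector, banach}) \<Rightarrow> bool" where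
  "completion_of D nrm i \<longleftrightarrow> csubspace D \<and> clinear_on D i \<and>
     (\<forall>x\<in>D. norm (i x) = nrm x) \<and> closure (i ` D) = UNIV"

text \<open>
  Completions are given abstractly: the Hilbert space \<open>'b\<close> with the map \<open>i\<close> is the completion
  of \<open>D = dom h\<close> for the norm of \<open>h\<close>, and \<open>'b antidual\<close> with the map \<open>j\<close> is the completion of the
  vectors of finite dual norm, the duality pairing being an extension of the inner product of \<open>'a\<close>.
  The maps \<open>i\<close>, \<open>j\<close> are determined by these properties up to a unitary change of \<open>'b\<close>; only
  their values on \<open>D\<close> and on \<open>dual_form_dom D h\<close> matter.
\<close>

definition quasi_gelfand_triple ::
  "'a::chilbert_space set \<Rightarrow> ('a \<Rightarrow> 'a \<Rightarrow> complex) \<Rightarrow> ('a \<Rightarrow> 'b::chilbert_space)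
    \<Rightarrow> ('a \<Rightarrow> 'b antidual) \<Rightarrow> bool" where
  "quasi_gelfand_triple D h i j \<longleftrightarrow> gelfand_form D h \<and>
     completion_of D (form_norm h) i \<and>
     (\<forall>x\<in>D. \<forall>y\<in>D. cinner (i x) (i y) = h x y) \<and>
     completion_of (dual_form_dom D h) (\<lambda>x'. enn2real (dual_form_norm D h x')) j \<and>
     (\<forall>x'\<in>dual_form_dom D h. \<forall>x\<in>D. antidual_apply (j x') (i x) = cinner x' x)"


section \<open>Operator nodes\<close>

text \<open>
  Unbounded operators are partial functions; the library constants \<open>dom\<close> and \<open>Map.graph\<close> give
  the domain and the graph.
\<close>

definition linear_operator :: "('a::complex_vector \<rightharpoonup> 'b::complex_vector) \<Rightarrow> bool" where
  "linear_operator T \<longleftrightarrow> csubspace (dom T) \<and> clinear_on (dom T) (\<lambda>x. the (T x))"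

definition closed_operator ::
  "('a::complex_normed_vector \<rightharpoonup> 'b::complex_normed_vector) \<Rightarrow> bool" where
  "closed_operator T \<longleftrightarrow> closed (Map.graph T)"

definition op_fst :: "('a \<rightharpoonup> 'b \<times> 'c) \<Rightarrow> ('a \<rightharpoonup> 'b)" where
  "op_fst T = (\<lambda>v. map_option fst (T v))"

definition main_operator :: "('a \<times> 'u::zero \<rightharpoonup> 'b \<times> 'c) \<Rightarrow> ('a \<rightharpoonup> 'b)" where
  "main_operator T = (\<lambda>x. op_fst T (x, 0))"

definition pencil ::
  "('a::complex_normed_vector \<Rightarrow> 'b::complex_normed_vector) \<Rightarrow> ('a \<rightharpoonup> 'b) \<Rightarrow> complex \<Rightarrow> 'a \<Rightarrow> 'b" where
  "pencil e a l x = l *\<^sub>C e x - the (a x)"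

definition resolvent ::
  "('a::complex_normed_vector \<Rightarrow> 'b::complex_normed_vector) \<Rightarrow> ('a \<rightharpoonup> 'b) \<Rightarrow> complex \<Rightarrow> 'b \<Rightarrow> 'a" where
  "resolvent e a l = inv_into (dom a) (pencil e a l)"

definition resolvent_set ::
  "('a::complex_normed_vector \<Rightarrow> 'b::complex_normed_vector) \<Rightarrow> ('a \<rightharpoonup> 'b) \<Rightarrow> complex set" where
  "resolvent_set e a =
     {l. bij_betw (pencil e a l) (dom a) UNIV \<and> bounded_clinear (resolvent e a l)}"

definition operator_node ::
  "('x::complex_normed_vector \<Rightarrow> 'z::complex_normed_vector) \<Rightarrow>
   ('x \<times> 'u::complex_normed_vector \<rightharpoonup> 'z \<times> 'y::complex_normed_vector) \<Rightarrow> bool" where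
  "operator_node e T \<longleftrightarrow> linear_operator T \<and> closed_operator T \<and> bounded_clinear e \<and>
     closed_operator (op_fst T) \<and> resolvent_set e (main_operator T) \<noteq> {} \<and>
     closure (dom (main_operator T)) = UNIV \<and> (\<forall>u. \<exists>x. (x, u) \<in> dom T)"

text \<open>
  In both growth bounds below the exponent \<open>p - 1\<close> is an integer which may be \<open>-1\<close>. The convention
  \<open>0 powi -1 = 0\<close> is irrelevant, since \<open>\<omega>\<close> may be enlarged.
\<close>

definition system_node ::
  "('x::complex_normed_vector \<Rightarrow> 'z::complex_normed_vector) \<Rightarrow>
   ('x \<times> 'u::complex_normed_vector \<rightharpoonup> 'z \<times> 'y::complex_normed_vector) \<Rightarrow> bool" where
  "system_node e T \<longleftrightarrow> operator_node e T \<and>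
     (\<exists>p::nat. \<exists>M\<^sub>0>0. \<exists>\<omega>::real. \<forall>l. Re l \<ge> \<omega> \<longrightarrow>
        l \<in> resolvent_set e (main_operator T) \<and>
        onorm (resolvent e (main_operator T) l) \<le> M\<^sub>0 * (1 + cmod l powi (int p - 1)))"

definition resolvent_growth ::
  "('a::complex_normed_vector \<Rightarrow> 'b::complex_normed_vector) \<Rightarrow> ('a \<rightharpoonup> 'b) \<Rightarrow> nat \<Rightarrow> bool" where
  "resolvent_growth e a p \<longleftrightarrow> (\<exists>\<omega>::real. \<exists>C>0. \<forall>l. Re l > \<omega> \<longrightarrow>
     l \<in> resolvent_set e a \<and> onorm (resolvent e a l) \<le> C * cmod l powi (int p - 1))"

text \<open>The index is \<open>\<infinity>\<close> if no bound of the required form holds.\<close>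

definition complex_resolvent_index ::
  "('a::complex_normed_vector \<Rightarrow> 'b::complex_normed_vector) \<Rightarrow> ('a \<rightharpoonup> 'b) \<Rightarrow> enat" where
  "complex_resolvent_index e a = Inf {enat p | p. resolvent_growth e a p}"


section \<open>Dissipation nodes and port-Hamiltonian nodes\<close>

text \<open>
  The pairing of \<open>(z', u) \<in> Z\<^sub>h\<^sup>* \<times> U\<close> with \<open>(z, y) \<in> Z\<^sub>h \<times> U\<^sup>*\<close>, where
  \<open>\<langle>u, y\<rangle>\<close> over \<open>U, U\<^sup>*\<close> is the conjugate of \<open>\<langle>y, u\<rangle>\<close> over \<open>U\<^sup>*, U\<close>.
\<close>

definition node_pairing ::
  "'z::complex_normed_vector antidual \<times> 'u::complex_normed_vector \<Rightarrow> 'z \<times> 'u antidual \<Rightarrow> complex" where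
  "node_pairing v w = antidual_apply (fst v) (fst w) + cnj (antidual_apply (snd w) (snd v))"

definition dissipation_node ::
  "('z::chilbert_space antidual \<times> 'u::chilbert_space \<rightharpoonup> 'z \<times> 'u antidual) \<Rightarrow> bool" where
  "dissipation_node M \<longleftrightarrow> operator_node (inv riesz) M \<and>
     (\<forall>v\<in>dom M. Re (node_pairing v (the (M v))) \<le> 0) \<and>
     resolvent_set (inv riesz) (main_operator M) \<inter> {l. Re l > 0} \<noteq> {}"

text \<open>\<open>S = diag(I, -I) M diag(\<R> Q, I)\<close> with its natural domain.\<close>

definition port_hamiltonian_map ::
  "('x \<Rightarrow> 'z::chilbert_space) \<Rightarrow> ('z antidual \<times> 'u \<rightharpoonup> 'z \<times> 'u::chilbert_space antidual) \<Rightarrow>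
   ('x \<times> 'u \<rightharpoonup> 'z \<times> 'u antidual)" where
  "port_hamiltonian_map Q M =
     (\<lambda>(x, u). map_option (\<lambda>(z, y). (z, - y)) (M (riesz (Q x), u)))"

text \<open>On \<open>Z\<^sub>h\<close> the extension of the form is the inner product, so \<open>h\<^sub>Z(Q x, E x)\<close> reads \<open>cinner (Q x) (E x)\<close>.\<close>

definition port_hamiltonian_operator_node ::
  "('x::chilbert_space \<Rightarrow> 'z::chilbert_space) \<Rightarrow> ('x \<Rightarrow> 'z) \<Rightarrow>
   ('z antidual \<times> 'u::chilbert_space \<rightharpoonup> 'z \<times> 'u antidual) \<Rightarrow>
   ('x \<times> 'u \<rightharpoonup> 'z \<times> 'u antidual) \<Rightarrow> bool" where
  "port_hamiltonian_operator_node E Q M S \<longleftrightarrow>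
     bounded_clinear E \<and> bounded_clinear Q \<and> dissipation_node M \<and>
     S = port_hamiltonian_map Q M \<and>
     (\<forall>x. cinner (Q x) (E x) \<in> \<real> \<and> 0 \<le> Re (cinner (Q x) (E x))) \<and>
     resolvent_set E (main_operator M \<circ> riesz \<circ> Q) \<inter> {l. Re l > 0} \<noteq> {}"

definition port_hamiltonian_system_node ::
  "('x::chilbert_space \<Rightarrow> 'z::chilbert_space) \<Rightarrow> ('x \<Rightarrow> 'z) \<Rightarrow>
   ('z antidual \<times> 'u::chilbert_space \<rightharpoonup> 'z \<times> 'u antidual) \<Rightarrow>
   ('x \<times> 'u \<rightharpoonup> 'z \<times> 'u antidual) \<Rightarrow> bool" where
  "port_hamiltonian_system_node E Q M S \<longleftrightarrow>
     port_hamiltonian_operator_node E Q M S \<and> system_node E S"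

text \<open>The inner product is real here, so taking the real part loses nothing.\<close>

definition hamiltonian :: "('x \<Rightarrow> 'z::chilbert_space) \<Rightarrow> ('x \<Rightarrow> 'z) \<Rightarrow> 'x \<Rightarrow> real" where
  "hamiltonian E Q x = Re (cinner (Q x) (E x)) / 2"


section \<open>Trajectories\<close>

text \<open>
  Functions on \<open>[0, \<infinity>)\<close> are functions on \<open>real\<close> whose values at negative arguments are irrelevant.
  A trajectory is a quadruple \<open>(x, u, w, y)\<close> with \<open>w = E x\<close>; the derivative at \<open>0\<close> is one-sided.
\<close>

definition classical_trajectory ::
  "('x::complex_normed_vector \<Rightarrow> 'z::complex_normed_vector) \<Rightarrow>
   ('x \<times> 'u::complex_normed_vector \<rightharpoonup> 'z \<times> 'y::complex_normed_vector) \<Rightarrow>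
   (real \<Rightarrow> 'x) \<Rightarrow> (real \<Rightarrow> 'u) \<Rightarrow> (real \<Rightarrow> 'z) \<Rightarrow> (real \<Rightarrow> 'y) \<Rightarrow> bool" where
  "classical_trajectory E S x u w y \<longleftrightarrow>
     continuous_on {0..} x \<and> continuous_on {0..} u \<and> continuous_on {0..} y \<and>
     (\<forall>t\<ge>0. w t = E (x t)) \<and>
     (\<exists>w'. continuous_on {0..} w' \<and>
        (\<forall>t\<ge>0. (w has_vector_derivative w' t) (at t within {0..}) \<and>
               S (x t, u t) = Some (w' t, y t)))"

text \<open>
  Strong (Bochner) measurability: the library's Bochner theory needs separable spaces, which is not
  assumed here.
\<close>

definition strongly_measurable :: "'t measure \<Rightarrow> ('t \<Rightarrow> 'b::topological_space) \<Rightarrow> bool" where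
  "strongly_measurable N f \<longleftrightarrow>
     (\<exists>s. (\<forall>n::nat. simple_function N (s n)) \<and> (AE t in N. (\<lambda>n. s n t) \<longlonglongrightarrow> f t))"

definition L2_sqnorm :: "(real \<Rightarrow> 'b::real_normed_vector) \<Rightarrow> ennreal" where
  "L2_sqnorm f = (\<integral>\<^sup>+t. ennreal ((norm (f t))\<^sup>2) \<partial>lebesgue_on {0..})"

definition L2_fun :: "(real \<Rightarrow> 'b::real_normed_vector) \<Rightarrow> bool" where
  "L2_fun f \<longleftrightarrow> strongly_measurable (lebesgue_on {0..}) f \<and> L2_sqnorm f < \<infinity>"

definition C_limit :: "(nat \<Rightarrow> real \<Rightarrow> 'b::metric_space) \<Rightarrow> (real \<Rightarrow> 'b) \<Rightarrow> bool" where
  "C_limit fs f \<longleftrightarrow> (\<forall>T\<ge>0. uniform_limit {0..T} fs f sequentially)"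

definition L2_limit :: "(nat \<Rightarrow> real \<Rightarrow> 'b::real_normed_vector) \<Rightarrow> (real \<Rightarrow> 'b) \<Rightarrow> bool" where
  "L2_limit fs f \<longleftrightarrow> (\<lambda>n. L2_sqnorm (\<lambda>t. fs n t - f t)) \<longlonglongrightarrow> 0"

definition generalized_trajectory ::
  "('x::complex_normed_vector \<Rightarrow> 'z::complex_normed_vector) \<Rightarrow>
   ('x \<times> 'u::complex_normed_vector \<rightharpoonup> 'z \<times> 'y::complex_normed_vector) \<Rightarrow>
   (real \<Rightarrow> 'x) \<Rightarrow> (real \<Rightarrow> 'u) \<Rightarrow> (real \<Rightarrow> 'z) \<Rightarrow> (real \<Rightarrow> 'y) \<Rightarrow> bool" where
  "generalized_trajectory E S x u w y \<longleftrightarrow>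
     continuous_on {0..} x \<and> L2_fun u \<and> continuous_on {0..} w \<and> L2_fun y \<and>
     (\<exists>xs us ws ys.
        (\<forall>n. classical_trajectory E S (xs n) (us n) (ws n) (ys n) \<and> L2_fun (us n) \<and> L2_fun (ys n)) \<and>
        C_limit xs x \<and> L2_limit us u \<and> C_limit ws w \<and> L2_limit ys y)"

definition dissipation_inequality ::
  "('x \<Rightarrow> real) \<Rightarrow> (real \<Rightarrow> 'x) \<Rightarrow> (real \<Rightarrow> 'u::complex_normed_vector) \<Rightarrow> (real \<Rightarrow> 'u antidual) \<Rightarrow> bool" where
  "dissipation_inequality H x u y \<longleftrightarrow>
     (\<forall>t\<ge>0. H (x t) - H (x 0) \<le> Re (LINT \<tau>:{0..t}|lebesgue. antidual_apply (y \<tau>) (u \<tau>)))"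

end

theory Submission
  imports Defs
begin

text \<open>
  Write \<open>a = F \<R> Q\<close> and \<open>f = (\<lambda> E - a) x\<close>. Dissipativity of the node gives
  \<open>Re \<lambda> \<langle>Q x, E x\<rangle> \<le> Re \<langle>Q x, f\<rangle>\<close>. If \<open>Q\<close> is invertible, the Cauchy--Schwarz inequality for the
  form \<open>\<langle>Q x, E y\<rangle>\<close> yields \<open>\<parallel>E x\<parallel>\<^sup>2 \<le> B \<langle>Q x, E x\<rangle>\<close>. Inserting both into
  \<open>x = (\<mu> E - a)\<^sup>-\<^sup>1 (f + (\<mu> - \<lambda>) E x)\<close> for one \<open>\<mu>\<close> in the resolvent set bounds \<open>\<parallel>x\<parallel>\<close> by a multiple of
  \<open>(1 + \<bar>\<lambda> - \<mu>\<bar>\<^sup>2 / Re \<lambda>) \<parallel>f\<parallel>\<close>. The bound is locally uniform, so the resolvent set extends along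
  segments to the whole right half-plane, and it is quadratic in \<open>\<lambda>\<close> for \<open>Re \<lambda> \<ge> 1\<close>.

  Along a classical trajectory the Hamiltonian has the derivative \<open>Re \<langle>Q x, (E x)'\<rangle>\<close>, which
  dissipativity bounds by \<open>Re \<langle>y, u\<rangle>\<close>. Both sides of the integrated inequality are continuous in
  the topology that defines generalized trajectories.
\<close>

section \<open>Complex Hilbert spaces\<close>

lemma scaleC_1 [simp]: "1 *\<^sub>C (x::'a::complex_vector) = x"
  using scaleR_eq_scaleC[of 1 x] by simp

lemma scaleC_zero_right [simp]: "c *\<^sub>C (0::'a::complex_vector) = 0"
  using scaleC_add_right[of c 0 "0::'a"] by simp

lemma scaleC_zero_left [simp]: "0 *\<^sub>C (x::'a::complex_vector) = 0"
  using scaleC_add_left[of 0 0 x] by simp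

lemma scaleC_minus_right: "c *\<^sub>C (- x) = - (c *\<^sub>C (x::'a::complex_vector))"
  using scaleC_add_right[of c x "- x"] by (simp add: eq_neg_iff_add_eq_0 add.commute)

lemma scaleC_minus_left: "(- c) *\<^sub>C x = - (c *\<^sub>C (x::'a::complex_vector))"
  using scaleC_add_left[of c "- c" x] by (simp add: eq_neg_iff_add_eq_0 add.commute)

lemma scaleC_diff_right: "c *\<^sub>C (x - y) = c *\<^sub>C x - c *\<^sub>C (y::'a::complex_vector)"
  using scaleC_add_right[of c x "- y"] by (simp add: scaleC_minus_right)

lemma scaleC_diff_left: "(c - d) *\<^sub>C x = c *\<^sub>C x - d *\<^sub>C (x::'a::complex_vector)"
  using scaleC_add_left[of c "- d" x] by (simp add: scaleC_minus_left)

text \<open>Antilinearity in the second argument is still linearity over the reals. This makes the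
  limit and continuity rules for real bilinear maps available for the sesquilinear product.\<close>

lemma bounded_bilinear_cinner:
  "bounded_bilinear (cinner :: 'a::chilbert_space \<Rightarrow> 'a \<Rightarrow> complex)"
proof
  show "cinner (a + a') b = cinner a b + cinner a' b" for a a' b :: 'a by (rule cinner_add_left)
  show "cinner a (b + b') = cinner a b + cinner a b'" for a b b' :: 'a by (rule cinner_add_right)
  show "cinner (r *\<^sub>R a) b = r *\<^sub>R cinner a b" for r and a b :: 'a
    by (simp add: scaleR_eq_scaleC cinner_scaleC_left scaleR_conv_of_real)
  show "cinner a (r *\<^sub>R b) = r *\<^sub>R cinner a b" for r and a b :: 'a
    by (simp add: scaleR_eq_scaleC cinner_scaleC_right scaleR_conv_of_real)
  show "\<exists>K. \<forall>a b::'a. norm (cinner a b) \<le> norm a * norm b * K"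
    by (rule exI[of _ 1]) (simp add: cinner_Cauchy_Schwarz)
qed

lemma bounded_bilinear_antidual_apply:
  "bounded_bilinear (antidual_apply :: 'a::complex_normed_vector antidual \<Rightarrow> 'a \<Rightarrow> complex)"
proof
  fix f g :: "'a antidual" and x y :: 'a and r :: real
  have "bounded_linear (antidual_apply f)"
    using antidual_apply[of f] by (simp add: bounded_antilinear_def)
  then show "antidual_apply f (x + y) = antidual_apply f x + antidual_apply f y"
    and "antidual_apply f (r *\<^sub>R x) = r *\<^sub>R antidual_apply f x"
    by (simp_all add: linear_simps)
  show "antidual_apply (f + g) x = antidual_apply f x + antidual_apply g x"
    by (simp add: plus_antidual.rep_eq)
  show "antidual_apply (r *\<^sub>R f) x = r *\<^sub>R antidual_apply f x"
    by (simp add: scaleR_antidual.rep_eq)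
next
  show "\<exists>K. \<forall>(f::'a antidual) x. norm (antidual_apply f x) \<le> norm f * norm x * K"
    by (rule exI[of _ 1]) (simp add: norm_antidual_apply)
qed

lemmas antidual_apply_zero_right = bounded_bilinear.zero_right[OF bounded_bilinear_antidual_apply]

lemma bounded_clinear_imp_bounded_linear: "bounded_clinear f \<Longrightarrow> bounded_linear f"
  by (simp add: bounded_clinear_def)

lemma bounded_clinear_scaleC: "bounded_clinear f \<Longrightarrow> f (c *\<^sub>C x) = c *\<^sub>C f x"
  by (simp add: bounded_clinear_def)

section \<open>The Riesz map into the anti-dual\<close>

lemma riesz_apply: "antidual_apply (riesz z) x = cinner z x"
  by (simp add: riesz.rep_eq)

lemma norm_riesz: "norm (riesz z) = norm (z::'a::chilbert_space)"
proof (rule antisym)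
  show "norm (riesz z) \<le> norm z"
    by (rule norm_antidual_bound) (simp_all add: riesz_apply cinner_Cauchy_Schwarz)
  have "norm z * norm z \<le> norm (riesz z) * norm z"
    using norm_antidual_apply[of "riesz z" z]
    by (simp add: riesz_apply cinner_self power2_eq_square norm_mult)
  then show "norm z \<le> norm (riesz z)"
    by (cases "z = 0") auto
qed

lemma bounded_clinear_riesz: "bounded_clinear (riesz :: 'a::chilbert_space \<Rightarrow> 'a antidual)"
proof -
  have scaleC: "riesz (c *\<^sub>C z) = c *\<^sub>C riesz z" for c and z :: 'a
    by (simp add: antidual_apply_inject[symmetric] fun_eq_iff riesz_apply scaleC_antidual.rep_eq
        cinner_scaleC_left)
  have "bounded_linear (riesz :: 'a \<Rightarrow> 'a antidual)"
  proof (rule bounded_linear_intro)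
    show "riesz (x + y) = riesz x + riesz y" for x y :: 'a
      by (simp add: antidual_apply_inject[symmetric] fun_eq_iff riesz_apply plus_antidual.rep_eq
          cinner_add_left)
    show "riesz (r *\<^sub>R x) = r *\<^sub>R riesz x" for r and x :: 'a
      by (simp add: scaleR_eq_scaleC scaleC)
    show "norm (riesz x) \<le> norm x * 1" for x :: 'a by (simp add: norm_riesz)
  qed
  then show ?thesis by (simp add: bounded_clinear_def scaleC)
qed

lemmas riesz_linear_simps = linear_simps[OF bounded_clinear_imp_bounded_linear[OF bounded_clinear_riesz]]

lemma inj_riesz: "inj (riesz :: 'a::chilbert_space \<Rightarrow> 'a antidual)"
proof (rule injI)
  fix x y :: 'a assume "riesz x = riesz y"
  then have "riesz (x - y) = 0"
    by (simp add: riesz_linear_simps)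
  then show "x = y" using norm_riesz[of "x - y"] by simp
qed

text \<open>
  Outside its range \<open>riesz\<close> has the constant inverse \<open>SOME z. False\<close>, which additivity rules out:
  if \<open>\<phi>\<close> is not in the range, then neither is \<open>\<phi> + riesz z\<close>, so that the two inverses differ
  by \<open>z\<close> and agree. This argument takes the place of the Riesz representation theorem.
\<close>

lemma surj_riesz:
  assumes "bounded_clinear (inv riesz :: 'a::chilbert_space antidual \<Rightarrow> 'a)"
  shows "surj (riesz :: 'a \<Rightarrow> 'a antidual)"
proof (rule ccontr)
  assume "\<not> surj (riesz :: 'a \<Rightarrow> 'a antidual)"
  then obtain \<phi> :: "'a antidual" where \<phi>: "\<phi> \<noteq> riesz z" for z by blast
  have lin: "inv riesz (f + g) = inv riesz f + inv riesz g" for f g :: "'a antidual"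
    using assms by (simp add: bounded_clinear_def linear_simps)
  have zero: "z = 0" for z :: 'a
  proof -
    have "\<phi> + riesz z \<noteq> riesz y" for y
    proof
      assume "\<phi> + riesz z = riesz y"
      then have "\<phi> = riesz (y - z)"
        by (simp add: riesz_linear_simps eq_diff_eq)
      then show False using \<phi> by blast
    qed
    then have "(\<lambda>y. riesz y = \<phi> + riesz z) = (\<lambda>y. riesz y = \<phi>)"
      using \<phi> by (metis (full_types))
    then have "inv riesz (\<phi> + riesz z) = inv riesz \<phi>"
      by (simp add: inv_def)
    then show "z = 0" by (simp add: lin inv_f_f[OF inj_riesz])
  qed
  \<comment> \<open>Only the zero vector is left in the space, so every functional agrees with
    \<open>riesz 0\<close>.\<close>
  have "antidual_apply \<phi> x = antidual_apply (riesz 0) x" for x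
    using zero[of x] by (simp add: antidual_apply_zero_right)
  then have "\<phi> = riesz 0"
    by (simp add: antidual_apply_inject[symmetric] fun_eq_iff)
  then show False using \<phi> by blast
qed


section \<open>Positive sesquilinear forms\<close>

text \<open>Polarisation: a real diagonal at \<open>x + y\<close> makes the imaginary parts of the
  two mixed values opposite, and a real diagonal at \<open>x + \<i> *\<^sub>C y\<close> makes their
  real parts equal.\<close>

lemma cinner_form_hermitian:
  fixes E Q :: "'x::chilbert_space \<Rightarrow> 'z::chilbert_space"
  assumes E: "bounded_clinear E" and Q: "bounded_clinear Q"
    and real: "\<And>x. cinner (Q x) (E x) \<in> \<real>"
  shows "cinner (Q y) (E x) = cnj (cinner (Q x) (E y))"
proof -
  define B where "B x y = cinner (Q x) (E y)" for x y
  have addl: "B (x + y) z = B x z + B y z" and addr: "B z (x + y) = B z x + B z y" for x y z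
    using E Q by (simp_all add: B_def bounded_clinear_def linear_simps cinner_add_left cinner_add_right)
  have scl: "B (c *\<^sub>C x) z = c * B x z" and scr: "B z (c *\<^sub>C x) = cnj c * B z x" for c x z
    using E Q by (simp_all add: B_def bounded_clinear_def cinner_scaleC_left cinner_scaleC_right)
  have im: "Im (B z z) = 0" for z
    using real[of z] by (simp add: B_def complex_is_Real_iff)
  have "Im (B x y) + Im (B y x) = 0"
    using im[of "x + y"] im[of x] im[of y] by (simp add: addl addr)
  moreover have "Re (B y x) - Re (B x y) = 0"
    using im[of "x + \<i> *\<^sub>C y"] im[of x] im[of y] by (simp add: addl addr scl scr)
  ultimately show ?thesis by (simp add: B_def complex_eq_iff)
qed

text \<open>The form may be degenerate, so \<open>y\<close> cannot be normalised. Instead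
  nonnegativity along a real line through \<open>x\<close> gives a real polynomial in
  \<open>s\<close> of degree at most two that is nowhere negative.\<close>

lemma cinner_form_Cauchy_Schwarz:
  fixes E Q :: "'x::chilbert_space \<Rightarrow> 'z::chilbert_space"
  assumes E: "bounded_clinear E" and Q: "bounded_clinear Q"
    and real: "\<And>x. cinner (Q x) (E x) \<in> \<real>" and pos: "\<And>x. 0 \<le> Re (cinner (Q x) (E x))"
  shows "(cmod (cinner (Q x) (E y)))\<^sup>2 \<le> Re (cinner (Q x) (E x)) * Re (cinner (Q y) (E y))"
proof -
  define B where "B x y = cinner (Q x) (E y)" for x y
  have addl: "B (x + y) z = B x z + B y z" and addr: "B z (x + y) = B z x + B z y" for x y z
    using E Q by (simp_all add: B_def bounded_clinear_def linear_simps cinner_add_left cinner_add_right)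
  have scl: "B (c *\<^sub>C x) z = c * B x z" and scr: "B z (c *\<^sub>C x) = cnj c * B z x" for c x z
    using E Q by (simp_all add: B_def bounded_clinear_def cinner_scaleC_left cinner_scaleC_right)
  have herm: "B y x = cnj (B x y)"
    unfolding B_def using E Q real by (rule cinner_form_hermitian)
  define c where "c = B x y"
  have quad: "0 \<le> Re (B x x) - 2 * s * (cmod c)\<^sup>2 + s\<^sup>2 * (cmod c)\<^sup>2 * Re (B y y)" for s :: real
  proof -
    \<comment> \<open>The factor \<open>c\<close> aligns the phases: both mixed terms become the
      same real number \<open>- s * (cmod c)\<^sup>2\<close>.\<close>
    define d where "d = - (complex_of_real s * c)"
    have "B (x + d *\<^sub>C y) (x + d *\<^sub>C y) = B x x + (cnj d * c + d * cnj c) + (d * cnj d) * B y y"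
      by (simp add: addl addr scl scr c_def herm algebra_simps)
    also have "cnj d * c + d * cnj c = complex_of_real (- (2 * s * (cmod c)\<^sup>2))"
      by (simp add: d_def complex_norm_square algebra_simps del: of_real_power)
    also have "d * cnj d = complex_of_real (s\<^sup>2 * (cmod c)\<^sup>2)"
      unfolding of_real_mult complex_norm_square by (simp add: d_def power2_eq_square)
    finally have "Re (B (x + d *\<^sub>C y) (x + d *\<^sub>C y)) =
        Re (B x x) - 2 * s * (cmod c)\<^sup>2 + s\<^sup>2 * (cmod c)\<^sup>2 * Re (B y y)"
      by simp
    then show ?thesis using pos[of "x + d *\<^sub>C y"] by (simp add: B_def)
  qed
  have "(cmod c)\<^sup>2 \<le> Re (B x x) * Re (B y y)"
  proof (cases "Re (B y y) = 0")
    case True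
    show ?thesis
    proof (rule ccontr)
      assume "\<not> ?thesis"
      then have "0 < (cmod c)\<^sup>2" using True by simp
      \<comment> \<open>The polynomial is now affine in \<open>s\<close>; at this argument its value
        is -1.\<close>
      then show False
        using quad[of "(Re (B x x) + 1) / (2 * (cmod c)\<^sup>2)"] True by (simp add: field_simps)
    qed
  next
    case False
    then have "0 < Re (B y y)" using pos[of y] by (simp add: B_def)
    \<comment> \<open>The minimiser of the quadratic polynomial is inserted.\<close>
    then show ?thesis
      using quad[of "1 / Re (B y y)"] by (simp add: field_simps power2_eq_square)
  qed
  then show ?thesis by (simp add: c_def B_def)
qed

text \<open>Cauchy-Schwarz is applied to \<open>P (E x)\<close> and \<open>x\<close> with
  \<open>P\<close> the inverse of \<open>Q\<close>. The mixed value is then the squared norm of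
  \<open>E x\<close>, and one factor of it cancels; the constant is the norm of \<open>E\<close>
  after \<open>P\<close>.\<close>

lemma norm_le_cinner_form:
  fixes E Q :: "'x::chilbert_space \<Rightarrow> 'z::chilbert_space"
  assumes E: "bounded_clinear E" and Q: "bounded_clinear Q"
    and real: "\<And>x. cinner (Q x) (E x) \<in> \<real>" and pos: "\<And>x. 0 \<le> Re (cinner (Q x) (E x))"
    and inv: "invertible_clinear Q"
  obtains B where "B \<ge> 0" "\<And>x. (norm (E x))\<^sup>2 \<le> B * Re (cinner (Q x) (E x))"
proof -
  obtain P where P: "bounded_clinear P" and QP: "Q (P z) = z" for z
    using inv by (auto simp: invertible_clinear_def fun_eq_iff)
  have EP: "bounded_linear (\<lambda>z. E (P z))"
    using E P by (intro bounded_linear_compose[of E P]) (auto simp: bounded_clinear_def)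
  show thesis
  proof
    show "0 \<le> onorm (\<lambda>z. E (P z))" by (rule onorm_pos_le[OF EP])
    fix x
    define n b where "n = (norm (E x))\<^sup>2" and "b = Re (cinner (Q x) (E x))"
    have "n\<^sup>2 \<le> Re (cinner (E x) (E (P (E x)))) * b"
      using cinner_form_Cauchy_Schwarz[OF E Q real pos, of "P (E x)" x]
      by (simp add: QP cinner_self n_def b_def norm_power)
    also have "Re (cinner (E x) (E (P (E x)))) \<le> norm (E x) * norm (E (P (E x)))"
      by (meson cinner_Cauchy_Schwarz complex_Re_le_cmod order_trans)
    also have "norm (E (P (E x))) \<le> onorm (\<lambda>z. E (P z)) * norm (E x)"
      by (rule onorm[OF EP])
    finally have "n\<^sup>2 \<le> n * (onorm (\<lambda>z. E (P z)) * b)"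
      using pos[of x] by (simp add: mult_left_mono mult_right_mono n_def b_def power2_eq_square algebra_simps)
    moreover have "0 \<le> n" "0 \<le> onorm (\<lambda>z. E (P z)) * b"
      using pos[of x] onorm_pos_le[OF EP] by (simp_all add: n_def b_def)
    ultimately show "(norm (E x))\<^sup>2 \<le> onorm (\<lambda>z. E (P z)) * Re (cinner (Q x) (E x))"
      unfolding n_def[symmetric] b_def[symmetric]
      by (cases "n = 0") (auto simp: power2_eq_square)
  qed
qed


section \<open>Operator pencils\<close>

lemma bounded_clinear_compose:
  "bounded_clinear f \<Longrightarrow> bounded_clinear g \<Longrightarrow> bounded_clinear (\<lambda>x. f (g x))"
  by (simp add: bounded_clinear_def bounded_linear_compose)

lemma linear_operator_add:
  assumes "linear_operator a" "x \<in> dom a" "y \<in> dom a"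
  shows "x + y \<in> dom a" "the (a (x + y)) = the (a x) + the (a y)"
  using assms by (auto simp: linear_operator_def csubspace_def clinear_on_def)

lemma linear_operator_scaleC:
  assumes "linear_operator a" "x \<in> dom a"
  shows "c *\<^sub>C x \<in> dom a" "the (a (c *\<^sub>C x)) = c *\<^sub>C the (a x)"
  using assms by (auto simp: linear_operator_def csubspace_def clinear_on_def)

lemma linear_operator_zero:
  assumes "linear_operator a"
  shows "0 \<in> dom a"
  using assms by (simp add: linear_operator_def csubspace_def)

lemma pencil_add:
  assumes "linear_operator a" "bounded_clinear e" "x \<in> dom a" "y \<in> dom a"
  shows "pencil e a l (x + y) = pencil e a l x + pencil e a l y"
  using assms by (simp add: pencil_def linear_operator_add bounded_clinear_def linear_simps scaleC_add_right)

lemma pencil_scaleC: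
  assumes "linear_operator a" "bounded_clinear e" "x \<in> dom a"
  shows "pencil e a l (c *\<^sub>C x) = c *\<^sub>C pencil e a l x"
  using assms by (simp add: pencil_def linear_operator_scaleC bounded_clinear_def scaleC_diff_right
      scaleC_scaleC mult.commute)

lemma pencil_shift: "pencil e a m x = pencil e a l x + (m - l) *\<^sub>C e x"
  by (simp add: pencil_def scaleC_diff_left)

section \<open>Resolvents and the extension of the resolvent set by a priori bounds\<close>

lemma resolvent_in_dom:
  assumes "l \<in> resolvent_set e a"
  shows "resolvent e a l f \<in> dom a"
proof -
  have "f \<in> pencil e a l ` dom a"
    using assms by (simp add: resolvent_set_def bij_betw_def)
  then show ?thesis unfolding resolvent_def by (rule inv_into_into)
qed

lemma pencil_resolvent:
  assumes "l \<in> resolvent_set e a"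
  shows "pencil e a l (resolvent e a l f) = f"
proof -
  have "f \<in> pencil e a l ` dom a"
    using assms by (simp add: resolvent_set_def bij_betw_def)
  then show ?thesis unfolding resolvent_def by (rule f_inv_into_f)
qed

lemma resolvent_pencil:
  assumes "l \<in> resolvent_set e a" "x \<in> dom a"
  shows "resolvent e a l (pencil e a l x) = x"
  using assms by (simp add: resolvent_set_def bij_betw_def resolvent_def)

text \<open>The a priori bound does double duty: it makes the kernel trivial and bounds the inverse.
  Surjectivity remains as the only separate requirement.\<close>

lemma resolvent_setI:
  assumes a: "linear_operator a" and e: "bounded_clinear e" and C: "0 \<le> C"
    and bound: "\<And>x. x \<in> dom a \<Longrightarrow> norm x \<le> C * norm (pencil e a l x)"
    and surj: "\<And>f. \<exists>x\<in>dom a. pencil e a l x = f"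
  shows "l \<in> resolvent_set e a" and "onorm (resolvent e a l) \<le> C"
proof -
  have inj: "inj_on (pencil e a l) (dom a)"
  proof (rule inj_onI)
    fix x y assume x: "x \<in> dom a" and y: "y \<in> dom a" and eq: "pencil e a l x = pencil e a l y"
    \<comment> \<open>The negative of \<open>y\<close> is written as a complex multiple, since
      closure under these is what the domain offers.\<close>
    have my: "(-1) *\<^sub>C y \<in> dom a" using a y by (rule linear_operator_scaleC)
    have "pencil e a l (x + (-1) *\<^sub>C y) = pencil e a l x + (-1) *\<^sub>C pencil e a l y"
      by (simp only: pencil_add[OF a e x my] pencil_scaleC[OF a e y])
    then have "pencil e a l (x + (-1) *\<^sub>C y) = 0"
      by (simp add: eq scaleC_minus_left)
    then show "x = y"
      using bound[OF linear_operator_add(1)[OF a x my]] by (simp add: scaleC_minus_left)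
  qed
  have bij: "bij_betw (pencil e a l) (dom a) UNIV"
    unfolding bij_betw_def using inj surj by (metis UNIV_eq_I imageI)
  define R where "R = resolvent e a l"
  have R: "R f \<in> dom a" "pencil e a l (R f) = f" for f
    using bij unfolding R_def resolvent_def bij_betw_def
    by (metis UNIV_I inv_into_into) (metis UNIV_I bij bij_betw_inv_into_right)
  \<comment> \<open>By injectivity, checking the equation for a candidate identifies the inverse;
    linearity of \<open>R\<close> follows this way.\<close>
  have R_eqI: "R f = x" if "x \<in> dom a" "pencil e a l x = f" for f x
    using that inj R[of f] by (auto dest: inj_onD)
  have add: "R (f + g) = R f + R g" for f g
    by (rule R_eqI) (simp_all add: linear_operator_add a e R pencil_add)
  have scaleC: "R (c *\<^sub>C f) = c *\<^sub>C R f" for c f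
    by (rule R_eqI) (simp_all add: linear_operator_scaleC a e R pencil_scaleC)
  have norm: "norm (R f) \<le> C * norm f" for f
    using bound[OF R(1), of f] by (simp add: R)
  have "bounded_linear R"
    by (rule bounded_linear_intro[of R C])
      (simp_all add: add scaleR_eq_scaleC scaleC norm mult.commute[of _ C])
  then have "bounded_clinear R"
    by (simp add: bounded_clinear_def scaleC)
  then show "l \<in> resolvent_set e a"
    using bij by (simp add: resolvent_set_def R_def)
  show "onorm (resolvent e a l) \<le> C"
    unfolding R_def[symmetric] by (rule onorm_bound[OF C norm])
qed

text \<open>A perturbation argument without Neumann series: a solution at \<open>m\<close> is a
  fixed point of \<open>x \<mapsto> resolvent e a l (f + (l - m) *\<^sub>C e x)\<close>, which is a
  contraction by \<open>close\<close>. Boundedness of the new inverse comes from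
  \<open>bound_m\<close>.\<close>

lemma resolvent_set_ball:
  fixes e :: "'a::{complex_normed_vector, banach} \<Rightarrow> 'b::complex_normed_vector"
  assumes a: "linear_operator a" and e: "bounded_clinear e" and l: "l \<in> resolvent_set e a"
    and N: "0 \<le> N" and bound_l: "\<And>x. x \<in> dom a \<Longrightarrow> norm x \<le> N * norm (pencil e a l x)"
    and bound_m: "\<And>x. x \<in> dom a \<Longrightarrow> norm x \<le> N * norm (pencil e a m x)"
    and close: "N * (cmod (l - m) * onorm e) < 1"
  shows "m \<in> resolvent_set e a"
proof (rule resolvent_setI(1)[OF a e N bound_m])
  fix f
  define T where "T x = resolvent e a l (f + (l - m) *\<^sub>C e x)" for x
  have el: "bounded_linear e" using e by (simp add: bounded_clinear_def)
  have Rl: "bounded_linear (resolvent e a l)"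
    using l by (simp add: resolvent_set_def bounded_clinear_def)
  have "dist (T x) (T y) \<le> N * (cmod (l - m) * onorm e) * dist x y" for x y
  proof -
    have "T x - T y = resolvent e a l ((l - m) *\<^sub>C e (x - y))"
      by (simp add: T_def linear_simps(2)[OF Rl, symmetric] linear_simps(2)[OF el] scaleC_diff_right)
    also have "norm \<dots> \<le> N * norm ((l - m) *\<^sub>C e (x - y))"
      using bound_l[OF resolvent_in_dom[OF l]] by (simp add: pencil_resolvent[OF l])
    also have "\<dots> \<le> N * (cmod (l - m) * (onorm e * norm (x - y)))"
      unfolding norm_scaleC using N onorm[OF el, of "x - y"] by (intro mult_left_mono) auto
    finally show ?thesis by (simp add: dist_norm algebra_simps)
  qed
  then obtain x where x: "T x = x"
    using banach_fix_type[of "N * (cmod (l - m) * onorm e)" T] N onorm_pos_le[OF el] close by auto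
  have "x \<in> dom a"
    using resolvent_in_dom[OF l, of "f + (l - m) *\<^sub>C e x"] x by (simp add: T_def)
  moreover have "pencil e a l x = f + (l - m) *\<^sub>C e x"
    using pencil_resolvent[OF l, of "f + (l - m) *\<^sub>C e x"] x by (simp add: T_def)
  then have "pencil e a m x = f"
    by (simp add: pencil_shift[of e a m x l] scaleC_diff_left)
  ultimately show "\<exists>x\<in>dom a. pencil e a m x = f" by blast
qed

text \<open>Since \<open>N\<close> is the same along the whole segment, the radius in
  \<open>resolvent_set_ball\<close> does not shrink, and finitely many equal steps lead from
  \<open>l\<close> to \<open>m\<close>.\<close>

lemma resolvent_set_segment:
  fixes e :: "'a::{complex_normed_vector, banach} \<Rightarrow> 'b::complex_normed_vector"
  assumes a: "linear_operator a" and e: "bounded_clinear e" and l: "l \<in> resolvent_set e a"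
    and N: "0 \<le> N"
    and bound: "\<And>k x. k \<in> closed_segment l m \<Longrightarrow> x \<in> dom a \<Longrightarrow> norm x \<le> N * norm (pencil e a k x)"
  shows "m \<in> resolvent_set e a"
proof -
  \<comment> \<open>The number of steps is chosen so that a step of length
    \<open>cmod (m - l) / n\<close> meets the smallness condition.\<close>
  obtain n :: nat where n: "N * (cmod (m - l) * onorm e) < real n"
    using reals_Archimedean2 by blast
  have npos: "0 < real n"
    using le_less_trans[OF mult_nonneg_nonneg[OF N mult_nonneg_nonneg[OF norm_ge_zero onorm_pos_le]] n]
      e by (simp add: bounded_clinear_def)
  define p where "p k = l + complex_of_real (real k / real n) * (m - l)" for k :: nat
  have seg: "p k \<in> closed_segment l m" if "k \<le> n" for k
    unfolding in_segment
    by (rule exI[of _ "real k / real n"]) (use that npos in \<open>simp add: p_def scaleR_conv_of_real algebra_simps del: of_real_divide\<close>)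
  have "k \<le> n \<Longrightarrow> p k \<in> resolvent_set e a" for k
  proof (induction k)
    case 0
    then show ?case using l by (simp add: p_def)
  next
    case (Suc k)
    have "p k - p (Suc k) = complex_of_real (- 1 / real n) * (m - l)"
      using npos by (simp add: p_def field_simps)
    then have "cmod (p k - p (Suc k)) = cmod (m - l) / real n"
      by (simp only: norm_mult norm_of_real) simp
    then have "N * (cmod (p k - p (Suc k)) * onorm e) < 1"
      using n npos by (simp add: pos_divide_less_eq)
    then show ?case
      using resolvent_set_ball[OF a e _ N, of "p k" "p (Suc k)"] Suc bound[OF seg] by auto
  qed
  from this[of n] show ?thesis using npos by (simp add: p_def)
qed


section \<open>Dissipative pencils\<close>

text \<open>What matters is that \<open>K\<close> depends neither on \<open>m\<close> nor on
  \<open>x\<close>. The term with \<open>E x\<close> is only of the order of the square root of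
  \<open>norm x * norm f\<close>, so it can be absorbed into the left-hand side.\<close>

lemma dissipative_pencil_bound:
  fixes E Q :: "'x::chilbert_space \<Rightarrow> 'z::chilbert_space" and a :: "'x \<rightharpoonup> 'z"
  assumes E: "bounded_clinear E" and Q: "bounded_clinear Q"
    and real: "\<And>x. cinner (Q x) (E x) \<in> \<real>" and pos: "\<And>x. 0 \<le> Re (cinner (Q x) (E x))"
    and inv: "invertible_clinear Q"
    and diss: "\<And>x. x \<in> dom a \<Longrightarrow> Re (cinner (Q x) (the (a x))) \<le> 0"
    and l: "l \<in> resolvent_set E a"
  obtains K where "K > 0"
    "\<And>m x. 0 < Re m \<Longrightarrow> x \<in> dom a \<Longrightarrow>
       norm x \<le> K * (1 + (cmod (m - l))\<^sup>2 / Re m) * norm (pencil E a m x)"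
proof -
  obtain B where B: "B \<ge> 0" "\<And>x. (norm (E x))\<^sup>2 \<le> B * Re (cinner (Q x) (E x))"
    using norm_le_cinner_form[OF E Q real pos inv] by blast
  define C where "C = onorm (resolvent E a l)"
  define q where "q = onorm Q"
  have Rl: "bounded_linear (resolvent E a l)" and Ql: "bounded_linear Q"
    using l Q by (simp_all add: resolvent_set_def bounded_clinear_def)
  have C: "0 \<le> C" and q: "0 \<le> q"
    using onorm_pos_le[OF Rl] onorm_pos_le[OF Ql] by (simp_all add: C_def q_def)
  \<comment> \<open>One constant that dominates both coefficients of the final estimate; the summand
    1 makes it positive.\<close>
  define K where "K = 2 * C + C\<^sup>2 * (B * q) + 1"
  have est: "norm x \<le> K * (1 + (cmod (m - l))\<^sup>2 / Re m) * norm (pencil E a m x)"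
    if m: "0 < Re m" and x: "x \<in> dom a" for m x
  proof -
    define f d s where "f = pencil E a m x" and "d = cmod (m - l)" and "s = norm x"
    define b where "b = Re (cinner (Q x) (E x))"
    have "cinner (Q x) (E x) = complex_of_real b"
      using real[of x] by (simp add: b_def complex_is_Real_iff complex_eq_iff)
    then have "cinner (Q x) (m *\<^sub>C E x) = cnj m * complex_of_real b"
      by (simp add: cinner_scaleC_right)
    \<comment> \<open>The conjugate of \<open>m\<close> is harmless: \<open>b\<close> is real and
      only the real part is taken.\<close>
    then have "Re (cinner (Q x) f) = Re m * b - Re (cinner (Q x) (the (a x)))"
      by (simp add: f_def pencil_def bounded_bilinear.diff_right[OF bounded_bilinear_cinner])
    then have "Re m * b \<le> Re (cinner (Q x) f)"
      using diss[OF x] by simp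
    also have "\<dots> \<le> norm (Q x) * norm f"
      by (meson cinner_Cauchy_Schwarz complex_Re_le_cmod order_trans)
    also have "\<dots> \<le> (q * s) * norm f"
      unfolding q_def s_def by (intro mult_right_mono onorm[OF Ql]) simp
    finally have "b \<le> q * s * norm f / Re m"
      using m by (simp add: field_simps)
    then have Ex: "(norm (E x))\<^sup>2 \<le> B * (q * s * norm f / Re m)"
      using B(2)[of x] B(1) unfolding b_def[symmetric] by (meson mult_left_mono order_trans)
    have "pencil E a l x = f + (l - m) *\<^sub>C E x"
      by (simp add: f_def pencil_shift[of E a l x m])
    then have "s = norm (resolvent E a l (f + (l - m) *\<^sub>C E x))"
      using resolvent_pencil[OF l x] by (simp add: s_def)
    also have "\<dots> \<le> C * norm (f + (l - m) *\<^sub>C E x)"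
      unfolding C_def by (rule onorm[OF Rl])
    also have "\<dots> \<le> C * (norm f + d * norm (E x))"
      using C norm_triangle_ineq[of f "(l - m) *\<^sub>C E x"]
      by (intro mult_left_mono) (simp_all add: norm_scaleC d_def norm_minus_commute)
    finally have s1: "s \<le> C * norm f + C * d * norm (E x)" by (simp add: algebra_simps)
    have "s \<le> 2 * C * norm f + C\<^sup>2 * d\<^sup>2 * (B * q * norm f / Re m)"
    proof (cases "s = 0")
      case True
      then show ?thesis using C B q m by simp
    next
      case False
      then have s: "0 < s" by (simp add: s_def)
      \<comment> \<open>Young's inequality. The squared norm of \<open>E x\<close> brings a factor
        \<open>s\<close> through \<open>Ex\<close>, so that \<open>s\<close> cancels; combined with
        twice \<open>s1\<close>, one copy of \<open>s\<close> is then absorbed.\<close>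
      have "2 * s * (C * d * norm (E x)) \<le> s\<^sup>2 + C\<^sup>2 * d\<^sup>2 * (norm (E x))\<^sup>2"
        using sum_squares_ge_zero[of "s - C * d * norm (E x)" 0]
        by (simp add: power2_eq_square algebra_simps)
      also have "C\<^sup>2 * d\<^sup>2 * (norm (E x))\<^sup>2 \<le> C\<^sup>2 * d\<^sup>2 * (B * (q * s * norm f / Re m))"
        using Ex by (intro mult_left_mono) auto
      finally have "s * (2 * (C * d * norm (E x))) \<le> s * (s + C\<^sup>2 * d\<^sup>2 * (B * q * norm f / Re m))"
        by (simp add: power2_eq_square algebra_simps)
      then have "2 * (C * d * norm (E x)) \<le> s + C\<^sup>2 * d\<^sup>2 * (B * q * norm f / Re m)"
        using s by (simp only: mult_le_cancel_left_pos)
      then show ?thesis using s1 by linarith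
    qed
    also have "\<dots> = (2 * C * 1 + C\<^sup>2 * (B * q) * (d\<^sup>2 / Re m)) * norm f"
      by (simp add: algebra_simps)
    also have "\<dots> \<le> (K * 1 + K * (d\<^sup>2 / Re m)) * norm f"
      using C B q m by (intro mult_right_mono add_mono) (simp_all add: K_def)
    finally show ?thesis by (simp add: s_def f_def d_def algebra_simps)
  qed
  have "K > 0" using C B q by (simp add: K_def add_nonneg_pos)
  then show thesis using est that by blast
qed

text \<open>The half-plane is convex, so the segment from \<open>l\<close> to any \<open>m\<close>
  stays inside it. Keeping the real part at least 1 removes the denominator and leaves quadratic
  growth.\<close>

lemma dissipative_resolvent_bound:
  fixes E Q :: "'x::chilbert_space \<Rightarrow> 'z::chilbert_space" and a :: "'x \<rightharpoonup> 'z"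
  assumes E: "bounded_clinear E" and Q: "bounded_clinear Q"
    and real: "\<And>x. cinner (Q x) (E x) \<in> \<real>" and pos: "\<And>x. 0 \<le> Re (cinner (Q x) (E x))"
    and inv: "invertible_clinear Q" and a: "linear_operator a"
    and diss: "\<And>x. x \<in> dom a \<Longrightarrow> Re (cinner (Q x) (the (a x))) \<le> 0"
    and l: "l \<in> resolvent_set E a" "0 < Re l"
  shows "{m. 0 < Re m} \<subseteq> resolvent_set E a"
    and "\<exists>C>0. \<forall>m. 1 \<le> Re m \<longrightarrow> onorm (resolvent E a m) \<le> C * (cmod m)\<^sup>2"
proof -
  obtain K where K: "K > 0"
    and bound: "\<And>m x. 0 < Re m \<Longrightarrow> x \<in> dom a \<Longrightarrow>
       norm x \<le> K * (1 + (cmod (m - l))\<^sup>2 / Re m) * norm (pencil E a m x)"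
    using dissipative_pencil_bound[OF E Q real pos inv diss l(1)] by blast
  have res: "m \<in> resolvent_set E a" if m: "0 < Re m" for m
  proof (rule resolvent_set_segment[OF a E l(1)])
    \<comment> \<open>The smallest real part on the segment; it turns the pointwise bounds into a
      uniform one.\<close>
    define r where "r = min (Re l) (Re m)"
    have r: "0 < r" using l m by (simp add: r_def)
    show "0 \<le> K * (1 + (cmod (m - l))\<^sup>2 / r)"
      using K r by simp
    fix k x assume k: "k \<in> closed_segment l m" and x: "x \<in> dom a"
    have "convex {z. r \<le> Re z}" by (rule convex_halfspace_Re_ge)
    then have "closed_segment l m \<subseteq> {z. r \<le> Re z}"
      by (intro closed_segment_subset) (simp_all add: r_def)
    then have rk: "r \<le> Re k" using k by blast
    have dk: "cmod (k - l) \<le> cmod (m - l)"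
      using segment_bound1[OF k] by (simp add: norm_minus_commute)
    have "(cmod (k - l))\<^sup>2 / Re k \<le> (cmod (m - l))\<^sup>2 / r"
      using r rk dk by (intro frac_le power_mono) auto
    then have "K * (1 + (cmod (k - l))\<^sup>2 / Re k) * norm (pencil E a k x)
        \<le> K * (1 + (cmod (m - l))\<^sup>2 / r) * norm (pencil E a k x)"
      using K by (intro mult_right_mono mult_left_mono) auto
    then show "norm x \<le> K * (1 + (cmod (m - l))\<^sup>2 / r) * norm (pencil E a k x)"
      using bound[of k x] r rk x by simp
  qed
  then show "{m. 0 < Re m} \<subseteq> resolvent_set E a" by blast
  \<comment> \<open>For \<open>1 \<le> cmod m\<close> both 1 and
    \<open>(cmod (m - l))\<^sup>2\<close> are bounded by multiples of
    \<open>(cmod m)\<^sup>2\<close>, with the factors 1 and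
    \<open>(1 + cmod l)\<^sup>2\<close>.\<close>
  define C where "C = K * (1 + (1 + cmod l)\<^sup>2)"
  have "onorm (resolvent E a m) \<le> C * (cmod m)\<^sup>2" if m: "1 \<le> Re m" for m
  proof (rule onorm_bound)
    show "0 \<le> C * (cmod m)\<^sup>2" using K by (simp add: C_def)
    fix f :: 'z
    have mm: "1 \<le> cmod m" using m complex_Re_le_cmod[of m] by linarith
    have mr: "m \<in> resolvent_set E a" using res m by simp
    have "cmod (m - l) \<le> cmod m * (1 + cmod l)"
      using norm_triangle_ineq4[of m l] mult_right_mono[OF mm norm_ge_zero[of l]]
      by (simp add: algebra_simps)
    then have "(cmod (m - l))\<^sup>2 \<le> (1 + cmod l)\<^sup>2 * (cmod m)\<^sup>2"
      unfolding power_mult_distrib[symmetric] by (intro power_mono) (simp_all add: mult.commute)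
    moreover have "(cmod (m - l))\<^sup>2 / Re m \<le> (cmod (m - l))\<^sup>2 / 1"
      using m by (intro divide_left_mono) auto
    moreover have "1 \<le> (cmod m)\<^sup>2" using mm by (simp add: one_le_power)
    ultimately have "1 + (cmod (m - l))\<^sup>2 / Re m \<le> (1 + (1 + cmod l)\<^sup>2) * (cmod m)\<^sup>2"
      unfolding distrib_right by simp
    then have "K * (1 + (cmod (m - l))\<^sup>2 / Re m) \<le> C * (cmod m)\<^sup>2"
      using K by (simp add: C_def mult.assoc)
    then have "K * (1 + (cmod (m - l))\<^sup>2 / Re m) * norm f \<le> C * (cmod m)\<^sup>2 * norm f"
      by (rule mult_right_mono) simp
    then show "norm (resolvent E a m f) \<le> C * (cmod m)\<^sup>2 * norm f"
      using bound[OF _ resolvent_in_dom[OF mr, of f], of m] m by (simp add: pencil_resolvent[OF mr])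
  qed
  moreover have "C > 0" using K by (simp add: C_def add_pos_nonneg)
  ultimately show "\<exists>C>0. \<forall>m. 1 \<le> Re m \<longrightarrow> onorm (resolvent E a m) \<le> C * (cmod m)\<^sup>2"
    by blast
qed


section \<open>Port-Hamiltonian nodes\<close>

text \<open>The sign change affects only the output component, which the main operator discards.
  Statements about \<open>S\<close> and about the pencil with \<open>Q\<close> can thus be
  exchanged.\<close>

lemma main_operator_port_hamiltonian_map:
  "main_operator (port_hamiltonian_map Q M) = main_operator M \<circ> riesz \<circ> Q"
proof
  fix x
  show "main_operator (port_hamiltonian_map Q M) x = (main_operator M \<circ> riesz \<circ> Q) x"
    by (cases "M (riesz (Q x), 0)")
      (simp_all add: main_operator_def op_fst_def port_hamiltonian_map_def split_beta)
qed

lemma port_hamiltonian_map_dom: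
  "(x, u) \<in> dom (port_hamiltonian_map Q M) \<longleftrightarrow> (riesz (Q x), u) \<in> dom M"
  by (auto simp: port_hamiltonian_map_def)

lemma port_hamiltonian_map_the:
  assumes "(riesz (Q x), u) \<in> dom M"
  shows "the (port_hamiltonian_map Q M (x, u)) =
    (fst (the (M (riesz (Q x), u))), - snd (the (M (riesz (Q x), u))))"
  using assms by (auto simp: port_hamiltonian_map_def)

section \<open>Transfer of the node properties from \<open>M\<close> to \<open>S\<close>\<close>

lemma linear_operator_port_hamiltonian_map:
  fixes M :: "'z::chilbert_space antidual \<times> 'u::chilbert_space \<rightharpoonup> 'z \<times> 'u antidual"
    and Q :: "'x::chilbert_space \<Rightarrow> 'z"
  assumes M: "linear_operator M" and Q: "bounded_clinear Q"
  shows "linear_operator (port_hamiltonian_map Q M)"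
proof -
  define R where "R x = riesz (Q x)" for x
  have "bounded_clinear R"
    unfolding R_def using Q by (rule bounded_clinear_compose[OF bounded_clinear_riesz])
  then have R: "R (x + y) = R x + R y" "R (c *\<^sub>C x) = c *\<^sub>C R x" "R 0 = 0" for x y c
    by (simp_all add: bounded_clinear_scaleC linear_simps[OF bounded_clinear_imp_bounded_linear])
  have dom: "(x, u) \<in> dom (port_hamiltonian_map Q M) \<longleftrightarrow> (R x, u) \<in> dom M" for x u
    by (simp only: port_hamiltonian_map_dom R_def)
  have val: "the (port_hamiltonian_map Q M (x, u)) = (fst (the (M (R x, u))), - snd (the (M (R x, u))))"
    if "(R x, u) \<in> dom M" for x u
    using port_hamiltonian_map_the[where Q = Q and M = M and x = x and u = u] that by (simp only: R_def)
  have add: "(R (x + y), u + v) \<in> dom M" "the (M (R (x + y), u + v)) = the (M (R x, u)) + the (M (R y, v))"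
    if "(R x, u) \<in> dom M" "(R y, v) \<in> dom M" for x y u v
    using linear_operator_add[OF M that] by (simp_all add: R)
  have scaleC: "(R (c *\<^sub>C x), c *\<^sub>C u) \<in> dom M" "the (M (R (c *\<^sub>C x), c *\<^sub>C u)) = c *\<^sub>C the (M (R x, u))"
    if "(R x, u) \<in> dom M" for c x u
    using linear_operator_scaleC[OF M that, of c] by (simp_all add: R scaleC_prod_def)
  show ?thesis
    unfolding linear_operator_def csubspace_def clinear_on_def
  proof (intro conjI ballI allI)
    show "0 \<in> dom (port_hamiltonian_map Q M)"
      using linear_operator_zero[OF M] by (simp add: zero_prod_def dom R del: domIff)
    fix p q :: "'x \<times> 'u" and c :: complex
    obtain x u y v where pq: "p = (x, u)" "q = (y, v)" by fastforce
    assume "p \<in> dom (port_hamiltonian_map Q M)"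
    then have p: "(R x, u) \<in> dom M" by (simp only: pq dom)
    show "c *\<^sub>C p \<in> dom (port_hamiltonian_map Q M)"
      using scaleC(1)[OF p] by (simp add: pq scaleC_prod_def dom del: domIff)
    show "the (port_hamiltonian_map Q M (c *\<^sub>C p)) = c *\<^sub>C the (port_hamiltonian_map Q M p)"
      using scaleC[OF p, of c] p by (simp add: pq scaleC_prod_def val scaleC_minus_right del: domIff)
    assume "q \<in> dom (port_hamiltonian_map Q M)"
    then have q: "(R y, v) \<in> dom M" by (simp only: pq dom)
    show "p + q \<in> dom (port_hamiltonian_map Q M)"
      using add(1)[OF p q] by (simp add: pq dom del: domIff)
    show "the (port_hamiltonian_map Q M (p + q)) =
        the (port_hamiltonian_map Q M p) + the (port_hamiltonian_map Q M q)"
      using add[OF p q] p q by (simp add: pq val del: domIff)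
  qed
qed

text \<open>The graph is the preimage of the graph of \<open>M\<close> under a continuous map;
  negation is its own inverse, so the sign goes to the other side.\<close>

lemma closed_operator_port_hamiltonian_map:
  fixes M :: "'z::chilbert_space antidual \<times> 'u::chilbert_space \<rightharpoonup> 'z \<times> 'u antidual"
    and Q :: "'x::chilbert_space \<Rightarrow> 'z"
  assumes "closed_operator M" "bounded_clinear Q"
  shows "closed_operator (port_hamiltonian_map Q M)"
proof -
  define f where "f p = ((riesz (Q (fst (fst p))), snd (fst p)), (fst (snd p), - snd (snd p)))"
    for p :: "('x \<times> 'u) \<times> ('z \<times> 'u antidual)"
  have Q: "continuous_on UNIV (\<lambda>x. riesz (Q x))"
    using bounded_clinear_compose[OF bounded_clinear_riesz assms(2)]
    by (simp add: bounded_clinear_def linear_continuous_on)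
  have "continuous_on UNIV f"
    unfolding f_def by (intro continuous_intros continuous_on_compose2[OF Q]) auto
  then have "closed (f -` Map.graph M)"
    using assms(1) by (auto simp: closed_operator_def intro: closed_vimage)
  moreover have "Map.graph (port_hamiltonian_map Q M) = f -` Map.graph M"
    by (force simp: f_def Map.graph_def port_hamiltonian_map_def map_option_case split: option.splits)
  ultimately show ?thesis by (simp add: closed_operator_def)
qed

text \<open>Closedness does not pass from an operator to its first component in general, so the
  preimage argument is repeated for \<open>op_fst\<close>.\<close>

lemma closed_op_fst_port_hamiltonian_map:
  fixes M :: "'z::chilbert_space antidual \<times> 'u::chilbert_space \<rightharpoonup> 'z \<times> 'u antidual"
    and Q :: "'x::chilbert_space \<Rightarrow> 'z"
  assumes "closed_operator (op_fst M)" "bounded_clinear Q"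
  shows "closed_operator (op_fst (port_hamiltonian_map Q M))"
proof -
  define f where "f p = ((riesz (Q (fst (fst p))), snd (fst p)), snd p)"
    for p :: "('x \<times> 'u) \<times> 'z"
  have Q: "continuous_on UNIV (\<lambda>x. riesz (Q x))"
    using bounded_clinear_compose[OF bounded_clinear_riesz assms(2)]
    by (simp add: bounded_clinear_def linear_continuous_on)
  have "continuous_on UNIV f"
    unfolding f_def by (intro continuous_intros continuous_on_compose2[OF Q]) auto
  then have "closed (f -` Map.graph (op_fst M))"
    using assms(1) by (auto simp: closed_operator_def intro: closed_vimage)
  moreover have "Map.graph (op_fst (port_hamiltonian_map Q M)) = f -` Map.graph (op_fst M)"
    by (force simp: f_def Map.graph_def op_fst_def port_hamiltonian_map_def map_option_case split: option.splits)
  ultimately show ?thesis by (simp add: closed_operator_def)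
qed

lemma linear_main_operator:
  assumes "linear_operator T"
  shows "linear_operator (main_operator T)"
proof -
  have dom: "x \<in> dom (main_operator T) \<longleftrightarrow> (x, 0) \<in> dom T" for x
    by (auto simp: main_operator_def op_fst_def)
  have val: "the (main_operator T x) = fst (the (T (x, 0)))" if "(x, 0) \<in> dom T" for x
    using that by (auto simp: main_operator_def op_fst_def)
  show ?thesis
    unfolding linear_operator_def csubspace_def clinear_on_def
  proof (intro conjI ballI allI)
    show "0 \<in> dom (main_operator T)"
      using linear_operator_zero[OF assms] by (simp only: dom zero_prod_def)
    fix x y and c :: complex
    assume "x \<in> dom (main_operator T)"
    then have x: "(x, 0) \<in> dom T" by (simp only: dom)
    note cx = linear_operator_scaleC[OF assms x, of c, unfolded scaleC_prod_def fst_conv snd_conv scaleC_zero_right]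
    show "c *\<^sub>C x \<in> dom (main_operator T)" using cx(1) by (simp only: dom)
    show "the (main_operator T (c *\<^sub>C x)) = c *\<^sub>C the (main_operator T x)"
      by (simp add: val[OF x] val[OF cx(1)] cx(2))
    assume "y \<in> dom (main_operator T)"
    then have y: "(y, 0) \<in> dom T" by (simp only: dom)
    note xy = linear_operator_add[OF assms x y, unfolded add_Pair add_0_right]
    show "x + y \<in> dom (main_operator T)" using xy(1) by (simp only: dom)
    show "the (main_operator T (x + y)) = the (main_operator T x) + the (main_operator T y)"
      by (simp add: val[OF x] val[OF y] val[OF xy(1)] xy(2))
  qed
qed

text \<open>At input 0 the part of the pairing over \<open>U\<close> vanishes, and what is left of
  the node's dissipativity is an inner product with \<open>Q x\<close>.\<close>

lemma dissipative_main_operator: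
  assumes M: "dissipation_node M" and x: "x \<in> dom (main_operator M \<circ> riesz \<circ> Q)"
  shows "Re (cinner (Q x) (the ((main_operator M \<circ> riesz \<circ> Q) x))) \<le> 0"
proof -
  obtain z y where Mz: "M (riesz (Q x), 0) = Some (z, y)"
    using x by (auto simp: main_operator_def op_fst_def)
  then have "Re (node_pairing (riesz (Q x), 0) (z, y)) \<le> 0"
    using M unfolding dissipation_node_def by (metis domI option.sel)
  then show ?thesis
    using Mz by (simp add: node_pairing_def riesz_apply antidual_apply_zero_right main_operator_def op_fst_def)
qed

text \<open>The preimage is the image of \<open>A\<close> under the continuous inverse, and a
  continuous surjection maps dense sets to dense sets.\<close>

lemma closure_vimage_invertible:
  assumes f: "bounded_clinear f" "invertible_clinear f" and A: "closure A = UNIV"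
  shows "closure (f -` A) = UNIV"
proof -
  obtain g where g: "bounded_clinear g" "\<And>x. g (f x) = x" "\<And>y. f (g y) = y"
    using f(2) by (auto simp: invertible_clinear_def fun_eq_iff)
  have "continuous_on (closure A) g"
    using g(1) by (simp add: bounded_clinear_def linear_continuous_on)
  then have "g ` closure A \<subseteq> closure (g ` A)"
    by (meson closure_subset image_closure_subset closed_closure)
  moreover have "g ` A = f -` A"
  proof
    show "f -` A \<subseteq> g ` A"
    proof
      fix x assume "x \<in> f -` A"
      then have "g (f x) \<in> g ` A" by blast
      then show "x \<in> g ` A" by (simp only: g(2))
    qed
  qed (auto simp: g)
  moreover have "range g = UNIV" using g by (metis surjI)
  ultimately show ?thesis using A by auto
qed

text \<open>The premise is available because a dissipation node is an operator node for
  \<open>inv riesz\<close>, which includes boundedness of that map.\<close>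

lemma invertible_riesz:
  assumes "bounded_clinear (inv riesz :: 'a::chilbert_space antidual \<Rightarrow> 'a)"
  shows "invertible_clinear (riesz :: 'a \<Rightarrow> 'a antidual)"
  unfolding invertible_clinear_def
  using assms inj_riesz surj_riesz[OF assms] by (auto simp: inj_iff surj_iff)

lemma invertible_clinear_compose:
  assumes "invertible_clinear f" "invertible_clinear g"
  shows "invertible_clinear (\<lambda>x. f (g x))"
proof -
  obtain f' g' where "bounded_clinear f'" "f' \<circ> f = id" "f \<circ> f' = id"
    and "bounded_clinear g'" "g' \<circ> g = id" "g \<circ> g' = id"
    using assms by (auto simp: invertible_clinear_def)
  then show ?thesis
    unfolding invertible_clinear_def
    by (intro exI[of _ "\<lambda>y. g' (f' y)"]) (simp add: bounded_clinear_compose fun_eq_iff)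
qed

text \<open>Density of the domain and the existence of a state for every input live on the state
  space of \<open>M\<close>; they are pulled back along the isomorphism given by
  \<open>riesz\<close> after \<open>Q\<close>.\<close>

lemma port_hamiltonian_operator_node_imp_operator_node:
  assumes node: "port_hamiltonian_operator_node E Q M S" and inv: "invertible_clinear Q"
  shows "operator_node E S"
proof -
  have E: "bounded_clinear E" and Q: "bounded_clinear Q" and S: "S = port_hamiltonian_map Q M"
    and M: "operator_node (inv riesz) M"
    and res: "resolvent_set E (main_operator M \<circ> riesz \<circ> Q) \<noteq> {}"
    using node unfolding port_hamiltonian_operator_node_def dissipation_node_def by blast+
  have RQ: "bounded_clinear (\<lambda>x. riesz (Q x))"
    using Q by (rule bounded_clinear_compose[OF bounded_clinear_riesz])
  have "invertible_clinear (\<lambda>x. riesz (Q x))"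
    using M unfolding operator_node_def by (intro invertible_clinear_compose[OF invertible_riesz inv]) blast
  note RQ = RQ this
  have "closure ((\<lambda>x. riesz (Q x)) -` dom (main_operator M)) = UNIV"
    using M by (intro closure_vimage_invertible RQ) (simp add: operator_node_def)
  also have "(\<lambda>x. riesz (Q x)) -` dom (main_operator M) = dom (main_operator S)"
    by (auto simp: S main_operator_port_hamiltonian_map)
  finally have dense: "closure (dom (main_operator S)) = UNIV" .
  have "\<exists>x. (x, u) \<in> dom S" for u
  proof -
    obtain z where z: "(z, u) \<in> dom M" using M unfolding operator_node_def by blast
    obtain x where x: "riesz (Q x) = z"
      using RQ(2) by (auto simp: invertible_clinear_def fun_eq_iff)
    show ?thesis using z unfolding S port_hamiltonian_map_dom x[symmetric] by blast
  qed
  then show ?thesis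
    using M E res dense Q unfolding operator_node_def
    by (simp add: S main_operator_port_hamiltonian_map
        linear_operator_port_hamiltonian_map closed_operator_port_hamiltonian_map
        closed_op_fst_port_hamiltonian_map)
qed

section \<open>The resolvent on the right half-plane\<close>

lemma port_hamiltonian_resolvent:
  assumes node: "port_hamiltonian_operator_node E Q M S" and inv: "invertible_clinear Q"
  shows "{l. Re l > 0} \<subseteq> resolvent_set E (main_operator M \<circ> riesz \<circ> Q)"
    and "\<exists>C>0. \<forall>l. 1 \<le> Re l \<longrightarrow>
      onorm (resolvent E (main_operator M \<circ> riesz \<circ> Q) l) \<le> C * (cmod l)\<^sup>2"
proof -
  have E: "bounded_clinear E" and Q: "bounded_clinear Q" and S: "S = port_hamiltonian_map Q M"
    and M: "dissipation_node M"
    and form: "\<And>x. cinner (Q x) (E x) \<in> \<real>" "\<And>x. 0 \<le> Re (cinner (Q x) (E x))"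
    using node by (auto simp: port_hamiltonian_operator_node_def)
  obtain l where l: "l \<in> resolvent_set E (main_operator M \<circ> riesz \<circ> Q)" "0 < Re l"
    using node by (auto simp: port_hamiltonian_operator_node_def)
  \<comment> \<open>The operator of the pencil is the main operator of \<open>S\<close>, so it
    inherits linearity from there.\<close>
  have "linear_operator S"
    using port_hamiltonian_operator_node_imp_operator_node[OF assms] by (simp add: operator_node_def)
  then have a: "linear_operator (main_operator M \<circ> riesz \<circ> Q)"
    unfolding S main_operator_port_hamiltonian_map[symmetric] by (rule linear_main_operator)
  note * = dissipative_resolvent_bound[OF E Q form inv a dissipative_main_operator[OF M] l]
  show "{l. Re l > 0} \<subseteq> resolvent_set E (main_operator M \<circ> riesz \<circ> Q)"
    by (rule *(1))
  show "\<exists>C>0. \<forall>l. 1 \<le> Re l \<longrightarrow>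
      onorm (resolvent E (main_operator M \<circ> riesz \<circ> Q) l) \<le> C * (cmod l)\<^sup>2"
    by (rule *(2))
qed

text \<open>Quadratic growth is the exponent \<open>p - 1\<close> with \<open>p = 3\<close>, and the
  index is an infimum over all admissible \<open>p\<close>.\<close>

lemma port_hamiltonian_resolvent_index:
  assumes node: "port_hamiltonian_operator_node E Q M S" and inv: "invertible_clinear Q"
  shows "complex_resolvent_index E (main_operator M \<circ> riesz \<circ> Q) \<le> 3"
proof -
  obtain C where C: "C > 0" "\<And>l. 1 \<le> Re l \<Longrightarrow>
      onorm (resolvent E (main_operator M \<circ> riesz \<circ> Q) l) \<le> C * (cmod l)\<^sup>2"
    using port_hamiltonian_resolvent(2)[OF assms] by blast
  have "resolvent_growth E (main_operator M \<circ> riesz \<circ> Q) 3"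
    unfolding resolvent_growth_def
  proof (rule exI[of _ 1], rule exI[of _ C], intro conjI allI impI)
    fix l :: complex assume l: "1 < Re l"
    then show "l \<in> resolvent_set E (main_operator M \<circ> riesz \<circ> Q)"
      using port_hamiltonian_resolvent(1)[OF assms] by (auto simp: subset_iff)
    show "onorm (resolvent E (main_operator M \<circ> riesz \<circ> Q) l) \<le> C * cmod l powi (int 3 - 1)"
      using C(2)[of l] l by simp
  qed (rule C)
  then have "enat 3 \<in> {enat p | p. resolvent_growth E (main_operator M \<circ> riesz \<circ> Q) p}"
    by blast
  then have "complex_resolvent_index E (main_operator M \<circ> riesz \<circ> Q) \<le> enat 3"
    unfolding complex_resolvent_index_def by (rule Inf_lower)
  then show ?thesis by (simp add: numeral_eq_enat)
qed

text \<open>The witnesses are \<open>p = 3\<close>, the growth constant \<open>C\<close> and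
  \<open>\<omega> = 1\<close>; the additional summand 1 in the growth bound of a system node only
  weakens it.\<close>

lemma port_hamiltonian_system_nodeI:
  assumes node: "port_hamiltonian_operator_node E Q M S" and inv: "invertible_clinear Q"
  shows "port_hamiltonian_system_node E Q M S"
proof -
  obtain C where C: "C > 0" "\<And>l. 1 \<le> Re l \<Longrightarrow>
      onorm (resolvent E (main_operator M \<circ> riesz \<circ> Q) l) \<le> C * (cmod l)\<^sup>2"
    using port_hamiltonian_resolvent(2)[OF assms] by blast
  have S: "main_operator S = main_operator M \<circ> riesz \<circ> Q"
    using node by (simp add: port_hamiltonian_operator_node_def main_operator_port_hamiltonian_map)
  have "l \<in> resolvent_set E (main_operator S) \<and>
      onorm (resolvent E (main_operator S) l) \<le> C * (1 + cmod l powi (int 3 - 1))"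
    if l: "1 \<le> Re l" for l
  proof
    show "l \<in> resolvent_set E (main_operator S)"
      using port_hamiltonian_resolvent(1)[OF assms] l by (auto simp: subset_iff S)
    have "onorm (resolvent E (main_operator S) l) \<le> C * (cmod l)\<^sup>2"
      using C(2)[OF l] by (simp add: S)
    also have "\<dots> \<le> C * (1 + cmod l powi (int 3 - 1))"
      using C(1) by simp
    finally show "onorm (resolvent E (main_operator S) l) \<le> C * (1 + cmod l powi (int 3 - 1))" .
  qed
  then have "system_node E S"
    unfolding system_node_def
    using port_hamiltonian_operator_node_imp_operator_node[OF assms] C(1)
    by (intro conjI, simp, rule_tac exI[of _ 3], rule_tac exI[of _ C], intro conjI, simp, rule_tac exI[of _ 1]) simp
  then show ?thesis using node by (simp add: port_hamiltonian_system_node_def)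
qed


section \<open>The dissipation inequality\<close>

text \<open>Difference quotients are needed as such, because they will stand inside an inner product
  whose other factor is merely continuous.\<close>

lemma has_vector_derivative_imp_tendsto:
  assumes "(w has_vector_derivative w') (at t within S)"
  shows "((\<lambda>s. (w s - w t) /\<^sub>R (s - t)) \<longlongrightarrow> w') (at t within S)"
proof -
  have lim: "((\<lambda>s. norm (w s - w t - (s - t) *\<^sub>R w') / norm (s - t)) \<longlongrightarrow> 0) (at t within S)"
    using assms by (simp add: has_vector_derivative_def has_derivative_iff_norm)
  have eq: "norm ((w s - w t) /\<^sub>R (s - t) - w') = norm (w s - w t - (s - t) *\<^sub>R w') / norm (s - t)"
    if "s \<noteq> t" for s
  proof -
    have "(w s - w t) /\<^sub>R (s - t) - w' = (w s - w t - (s - t) *\<^sub>R w') /\<^sub>R (s - t)"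
      using that by (simp add: scaleR_diff_right)
    then show ?thesis by (simp add: divide_inverse mult.commute)
  qed
  have "((\<lambda>s. norm ((w s - w t) /\<^sub>R (s - t) - w')) \<longlongrightarrow> 0) (at t within S)"
    by (rule Lim_transform_eventually[OF lim]) (simp add: eventually_at_filter eq)
  then have "((\<lambda>s. (w s - w t) /\<^sub>R (s - t) - w') \<longlongrightarrow> 0) (at t within S)"
    by (rule tendsto_norm_zero_cancel)
  then show ?thesis by (rule Lim_null[THEN iffD2])
qed

text \<open>
  Only \<open>E x\<close> is differentiable along a trajectory, \<open>x\<close> is merely continuous. Hence the product rule
  is replaced by the polarisation \<open>b(x, x) - b(y, y) = Re b(x + y, x - y)\<close> for Hermitian \<open>b\<close>.
\<close>

lemma hamiltonian_has_vector_derivative: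
  fixes E Q :: "'x::chilbert_space \<Rightarrow> 'z::chilbert_space"
  assumes E: "bounded_clinear E" and Q: "bounded_clinear Q"
    and real: "\<And>x. cinner (Q x) (E x) \<in> \<real>"
    and x: "continuous (at t within A) x" and t: "t \<in> A" and w: "\<And>s. s \<in> A \<Longrightarrow> w s = E (x s)"
    and w': "(w has_vector_derivative w') (at t within A)"
  shows "((\<lambda>s. hamiltonian E Q (x s)) has_vector_derivative Re (cinner (Q (x t)) w')) (at t within A)"
proof -
  \<comment> \<open>The mixed terms are conjugates of each other with opposite signs, so their real
    parts cancel.\<close>
  have quot: "(hamiltonian E Q (x s) - hamiltonian E Q (x t)) / (s - t) =
      Re (cinner (Q (x s + x t)) ((w s - w t) /\<^sub>R (s - t))) / 2" if s: "s \<in> A" for s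
  proof -
    have "cinner (Q (x t)) (E (x s)) = cnj (cinner (Q (x s)) (E (x t)))"
      by (rule cinner_form_hermitian[OF E Q real])
    then have "Re (cinner (Q (x s + x t)) (w s - w t)) =
        Re (cinner (Q (x s)) (E (x s))) - Re (cinner (Q (x t)) (E (x t)))"
      using w[OF s] w[OF t]
      by (simp add: linear_simps[OF bounded_clinear_imp_bounded_linear[OF Q]] cinner_add_left
          bounded_bilinear.diff_right[OF bounded_bilinear_cinner])
    then have "hamiltonian E Q (x s) - hamiltonian E Q (x t) = Re (cinner (Q (x s + x t)) (w s - w t)) / 2"
      by (simp add: hamiltonian_def diff_divide_distrib)
    then show ?thesis
      by (simp only: bounded_bilinear.scaleR_right[OF bounded_bilinear_cinner]) (simp add: field_simps)
  qed
  have xt: "((\<lambda>s. x s + x t) \<longlongrightarrow> x t + x t) (at t within A)"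
    using x unfolding continuous_within by (intro tendsto_add tendsto_const)
  have "((\<lambda>s. cinner (Q (x s + x t)) ((w s - w t) /\<^sub>R (s - t))) \<longlongrightarrow> cinner (Q (x t + x t)) w')
      (at t within A)"
    by (rule bounded_bilinear.tendsto[OF bounded_bilinear_cinner
          bounded_linear.tendsto[OF bounded_clinear_imp_bounded_linear[OF Q] xt]
          has_vector_derivative_imp_tendsto[OF w']])
  then have "((\<lambda>s. Re (cinner (Q (x s + x t)) ((w s - w t) /\<^sub>R (s - t))) / 2)
      \<longlongrightarrow> Re (cinner (Q (x t + x t)) w') / 2) (at t within A)"
    by (intro tendsto_divide tendsto_Re tendsto_const) simp_all
  \<comment> \<open>The doubled state compensates the factor 1/2 of the Hamiltonian.\<close>
  moreover have "cinner (Q (x t + x t)) w' = 2 * cinner (Q (x t)) w'"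
    by (simp add: linear_simps[OF bounded_clinear_imp_bounded_linear[OF Q]] cinner_add_left)
  ultimately have lim: "((\<lambda>s. Re (cinner (Q (x s + x t)) ((w s - w t) /\<^sub>R (s - t))) / 2)
      \<longlongrightarrow> Re (cinner (Q (x t)) w')) (at t within A)"
    by simp
  have "((\<lambda>s. (hamiltonian E Q (x s) - hamiltonian E Q (x t)) / (s - t))
      \<longlongrightarrow> Re (cinner (Q (x t)) w')) (at t within A)"
  proof (rule Lim_transform_eventually[OF lim])
    have "eventually (\<lambda>s. s \<in> A) (at t within A)" by (simp add: eventually_at_filter)
    then show "eventually (\<lambda>s. Re (cinner (Q (x s + x t)) ((w s - w t) /\<^sub>R (s - t))) / 2 =
        (hamiltonian E Q (x s) - hamiltonian E Q (x t)) / (s - t)) (at t within A)"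
      by eventually_elim (rule quot[symmetric])
  qed
  then show ?thesis
    by (simp add: has_real_derivative_iff_has_vector_derivative[symmetric] has_field_derivative_iff)
qed

text \<open>The power balance holds pointwise by dissipativity of \<open>M\<close> and is integrated
  over \<open>{0..t}\<close> with the fundamental theorem of calculus.\<close>

lemma classical_trajectory_dissipation_inequality:
  assumes node: "port_hamiltonian_operator_node E Q M S"
    and traj: "classical_trajectory E S x u w y"
  shows "dissipation_inequality (hamiltonian E Q) x u y"
  unfolding dissipation_inequality_def
proof (intro allI impI)
  fix t :: real assume t: "0 \<le> t"
  have E: "bounded_clinear E" and Q: "bounded_clinear Q" and S: "S = port_hamiltonian_map Q M"
    and M: "dissipation_node M" and real: "\<And>x. cinner (Q x) (E x) \<in> \<real>"
    using node by (auto simp: port_hamiltonian_operator_node_def)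
  obtain w' where x: "continuous_on {0..} x" and u: "continuous_on {0..} u"
    and y: "continuous_on {0..} y" and w: "\<And>s. s \<ge> 0 \<Longrightarrow> w s = E (x s)"
    and w': "\<And>s. s \<ge> 0 \<Longrightarrow> (w has_vector_derivative w' s) (at s within {0..})"
    and Sx: "\<And>s. s \<ge> 0 \<Longrightarrow> S (x s, u s) = Some (w' s, y s)"
    using traj by (auto simp: classical_trajectory_def)
  have deriv: "((\<lambda>s. hamiltonian E Q (x s)) has_vector_derivative Re (cinner (Q (x s)) (w' s)))
      (at s within {0..t})" if s: "s \<in> {0..t}" for s
  proof (rule has_vector_derivative_within_subset)
    show "((\<lambda>s. hamiltonian E Q (x s)) has_vector_derivative Re (cinner (Q (x s)) (w' s)))
        (at s within {0..})"
      using s x w by (intro hamiltonian_has_vector_derivative[OF E Q real _ _ _ w'])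
        (auto simp: continuous_on_eq_continuous_within)
  qed auto
  \<comment> \<open>The output of \<open>M\<close> is \<open>- y\<close>. This sign moves the
    supplied power to the right-hand side, and the conjugate in the pairing is invisible to the real
    part.\<close>
  have pow: "Re (cinner (Q (x s)) (w' s)) \<le> Re (antidual_apply (y s) (u s))" if s: "s \<in> {0..t}" for s
  proof -
    obtain z where Mz: "M (riesz (Q (x s)), u s) = Some (w' s, z)" and z: "y s = - z"
      using Sx[of s] s by (auto simp: S port_hamiltonian_map_def)
    then have "Re (node_pairing (riesz (Q (x s)), u s) (w' s, z)) \<le> 0"
      using M unfolding dissipation_node_def by (metis domI option.sel)
    then show ?thesis
      by (simp add: node_pairing_def riesz_apply z uminus_antidual.rep_eq)
  qed
  define p where "p s = antidual_apply (y s) (u s)" for s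
  have "continuous_on {0..t} p"
    unfolding p_def
    by (rule bounded_bilinear.continuous_on[OF bounded_bilinear_antidual_apply])
      (auto intro: continuous_on_subset[OF y] continuous_on_subset[OF u])
  then have p: "set_integrable lebesgue {0..t} p"
    by (rule absolutely_integrable_continuous_real)
  \<comment> \<open>The Lebesgue integral is read as a gauge integral, to be compared with the one
    that the fundamental theorem yields.\<close>
  have "(p has_integral (LINT s:{0..t}|lebesgue. p s)) {0..t}"
    using set_lebesgue_integral_eq_integral[OF p] by (simp add: has_integral_integral)
  then have "((\<lambda>s. Re (p s)) has_integral Re (LINT s:{0..t}|lebesgue. p s)) {0..t}"
    by (drule_tac has_integral_linear[OF _ bounded_linear_Re]) (simp add: o_def)
  moreover have "((\<lambda>s. Re (cinner (Q (x s)) (w' s))) has_integral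
      hamiltonian E Q (x t) - hamiltonian E Q (x 0)) {0..t}"
    by (rule fundamental_theorem_of_calculus[OF t deriv])
  ultimately show "hamiltonian E Q (x t) - hamiltonian E Q (x 0)
      \<le> Re (LINT s:{0..t}|lebesgue. antidual_apply (y s) (u s))"
    using pow by (auto simp: p_def intro: has_integral_le)
qed

section \<open>Measurability and limits of the supplied power\<close>

lemma strongly_measurable_diff:
  fixes f g :: "'t \<Rightarrow> 'b::real_normed_vector"
  assumes "strongly_measurable N f" "strongly_measurable N g"
  shows "strongly_measurable N (\<lambda>t. f t - g t)"
proof -
  obtain r s where rs: "\<And>n::nat. simple_function N (r n)" "\<And>n::nat. simple_function N (s n)"
    and lim: "AE t in N. (\<lambda>n. r n t) \<longlonglongrightarrow> f t" "AE t in N. (\<lambda>n. s n t) \<longlonglongrightarrow> g t"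
    using assms by (auto simp: strongly_measurable_def)
  have "AE t in N. (\<lambda>n. r n t - s n t) \<longlonglongrightarrow> f t - g t"
    using lim by eventually_elim (rule tendsto_diff)
  moreover have "simple_function N (\<lambda>t. r n t - s n t)" for n
    using rs by (rule simple_function_compose2)
  ultimately show ?thesis
    unfolding strongly_measurable_def by (intro exI[of _ "\<lambda>n t. r n t - s n t"]) simp
qed

text \<open>The value spaces may be non-separable, so measurability is obtained through the
  approximants: applying \<open>h\<close> to simple functions gives simple functions, and continuity
  of \<open>h\<close> preserves the limit almost everywhere.\<close>

lemma borel_measurable_strongly_measurable2:
  fixes A :: "'e::euclidean_space set" and h :: "'b::topological_space \<Rightarrow> 'c::topological_space \<Rightarrow> 'd::euclidean_space"
  assumes A: "A \<in> sets lebesgue"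
    and f: "strongly_measurable (lebesgue_on A) f" and g: "strongly_measurable (lebesgue_on A) g"
    and h: "continuous_on UNIV (\<lambda>p. h (fst p) (snd p))"
  shows "(\<lambda>t. h (f t) (g t)) \<in> borel_measurable (lebesgue_on A)"
proof -
  obtain r s where rs: "\<And>n::nat. simple_function (lebesgue_on A) (r n)" "\<And>n::nat. simple_function (lebesgue_on A) (s n)"
    and lim: "AE t in lebesgue_on A. (\<lambda>n. r n t) \<longlonglongrightarrow> f t" "AE t in lebesgue_on A. (\<lambda>n. s n t) \<longlonglongrightarrow> g t"
    using f g by (auto simp: strongly_measurable_def)
  \<comment> \<open>Extension by zero moves the argument to all of \<open>lebesgue\<close>, where
    changing a measurable function on a null set keeps it measurable.\<close>
  define q where "q n t = indicat_real A t *\<^sub>R h (r n t) (s n t)" for n t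
  have "(\<lambda>t. h (r n t) (s n t)) \<in> borel_measurable (lebesgue_on A)" for n
    by (rule borel_measurable_simple_function[OF simple_function_compose2[OF rs(1) rs(2)]])
  then have "q n \<in> borel_measurable lebesgue" for n
    using A by (simp add: q_def[abs_def] borel_measurable_restrict_space_iff)
  then have meas: "(\<lambda>t. lim (\<lambda>n. q n t)) \<in> borel_measurable lebesgue"
    by (rule borel_measurable_lim_metric)
  have "AE t in lebesgue_on A. (\<lambda>n. h (r n t) (s n t)) \<longlonglongrightarrow> h (f t) (g t)"
    using lim
  proof eventually_elim
    fix t assume "(\<lambda>n. r n t) \<longlonglongrightarrow> f t" "(\<lambda>n. s n t) \<longlonglongrightarrow> g t"
    then show "(\<lambda>n. h (r n t) (s n t)) \<longlonglongrightarrow> h (f t) (g t)"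
      using continuous_on_tendsto_compose[OF h, of "\<lambda>n. (r n t, s n t)" "(f t, g t)"]
      by (simp add: tendsto_Pair)
  qed
  then have "AE t in lebesgue. t \<in> A \<longrightarrow> (\<lambda>n. h (r n t) (s n t)) \<longlonglongrightarrow> h (f t) (g t)"
    using A by (simp add: AE_restrict_space_iff)
  \<comment> \<open>On the exceptional null set \<open>lim\<close> may take an arbitrary
    value.\<close>
  then have "AE t in lebesgue. lim (\<lambda>n. q n t) = indicat_real A t *\<^sub>R h (f t) (g t)"
  proof eventually_elim
    fix t assume "t \<in> A \<longrightarrow> (\<lambda>n. h (r n t) (s n t)) \<longlonglongrightarrow> h (f t) (g t)"
    then have "(\<lambda>n. q n t) \<longlonglongrightarrow> indicat_real A t *\<^sub>R h (f t) (g t)"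
      unfolding q_def by (cases "t \<in> A") simp_all
    then show "lim (\<lambda>n. q n t) = indicat_real A t *\<^sub>R h (f t) (g t)"
      by (rule limI)
  qed
  then have "(\<lambda>t. indicat_real A t *\<^sub>R h (f t) (g t)) \<in> borel_measurable lebesgue"
    by (rule borel_measurable_AE[OF meas])
  then show ?thesis using A by (simp add: borel_measurable_restrict_space_iff)
qed

lemma borel_measurable_norm_strongly_measurable:
  fixes f :: "'e::euclidean_space \<Rightarrow> 'b::real_normed_vector"
  assumes "A \<in> sets lebesgue" "strongly_measurable (lebesgue_on A) f"
  shows "(\<lambda>t. norm (f t)) \<in> borel_measurable (lebesgue_on A)"
  \<comment> \<open>The function itself serves as the dummy second argument.\<close>
  by (rule borel_measurable_strongly_measurable2[OF assms assms(2), of "\<lambda>a b. norm a"])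
    (intro continuous_intros)

lemma borel_measurable_antidual_apply:
  fixes g :: "'e::euclidean_space \<Rightarrow> 'b::complex_normed_vector"
  assumes "A \<in> sets lebesgue" "strongly_measurable (lebesgue_on A) f" "strongly_measurable (lebesgue_on A) g"
  shows "(\<lambda>t. antidual_apply (f t) (g t)) \<in> borel_measurable (lebesgue_on A)"
  by (rule borel_measurable_strongly_measurable2[OF assms])
    (intro bounded_bilinear.continuous_on[OF bounded_bilinear_antidual_apply] continuous_intros)

text \<open>Pointwise the pairing is bounded by the product of the norms; then the integral
  Cauchy-Schwarz inequality applies. The squared form avoids roots of extended reals.\<close>

lemma nn_integral_antidual_apply_le:
  fixes g :: "real \<Rightarrow> 'b::complex_normed_vector"
  assumes f: "strongly_measurable (lebesgue_on {0..}) f" and g: "strongly_measurable (lebesgue_on {0..}) g"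
  shows "(\<integral>\<^sup>+t. ennreal (cmod (antidual_apply (f t) (g t))) \<partial>lebesgue_on {0..})\<^sup>2 \<le> L2_sqnorm f * L2_sqnorm g"
proof -
  have [measurable]: "(\<lambda>t. norm (f t)) \<in> borel_measurable (lebesgue_on {0..})"
      "(\<lambda>t. norm (g t)) \<in> borel_measurable (lebesgue_on {0..})"
    using f g by (simp_all add: borel_measurable_norm_strongly_measurable)
  have "(\<integral>\<^sup>+t. ennreal (cmod (antidual_apply (f t) (g t))) \<partial>lebesgue_on {0..})
      \<le> (\<integral>\<^sup>+t. ennreal (norm (f t)) * ennreal (norm (g t)) \<partial>lebesgue_on {0..})"
    by (intro nn_integral_mono) (simp add: norm_antidual_apply ennreal_mult[symmetric])
  then have "(\<integral>\<^sup>+t. ennreal (cmod (antidual_apply (f t) (g t))) \<partial>lebesgue_on {0..})\<^sup>2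
      \<le> (\<integral>\<^sup>+t. ennreal (norm (f t)) * ennreal (norm (g t)) \<partial>lebesgue_on {0..})\<^sup>2"
    by (rule power_mono) simp
  also have "\<dots> \<le> (\<integral>\<^sup>+t. (ennreal (norm (f t)))\<^sup>2 \<partial>lebesgue_on {0..}) * (\<integral>\<^sup>+t. (ennreal (norm (g t)))\<^sup>2 \<partial>lebesgue_on {0..})"
    by (rule Cauchy_Schwarz_nn_integral) measurable
  finally show ?thesis by (simp add: L2_sqnorm_def ennreal_power)
qed

text \<open>The previous bound controls squares only; testing \<open>b\<close> against the squared
  threshold replaces taking roots.\<close>

lemma ennreal_tendsto_zero_of_square:
  fixes a b :: "nat \<Rightarrow> ennreal"
  assumes "\<And>n. (a n)\<^sup>2 \<le> b n" and b: "b \<longlonglongrightarrow> 0"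
  shows "a \<longlonglongrightarrow> 0"
proof (rule order_tendstoI)
  fix e :: ennreal assume "0 < e"
  then have "0 < e\<^sup>2" by (simp add: zero_less_iff_neq_zero)
  then have "eventually (\<lambda>n. b n < e\<^sup>2) sequentially"
    using order_tendstoD(2)[OF b] by blast
  then show "eventually (\<lambda>n. a n < e) sequentially"
  proof eventually_elim
    fix n assume "b n < e\<^sup>2"
    then have "(a n)\<^sup>2 < e\<^sup>2" using assms(1)[of n] by (rule le_less_trans[rotated])
    then show "a n < e" using power_mono[of e "a n" 2] by (meson leD leI zero_le)
  qed
qed simp

text \<open>The difference of the pairings splits into three, each containing at least one of the
  differences \<open>ys n - y\<close> and \<open>us n - u\<close>, and each tends to 0 by
  Cauchy-Schwarz.\<close>

lemma nn_integral_antidual_apply_diff_tendsto: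
  fixes us :: "nat \<Rightarrow> real \<Rightarrow> 'b::complex_normed_vector"
  assumes us: "\<And>n. L2_fun (us n)" "L2_fun u" "L2_limit us u"
    and ys: "\<And>n. L2_fun (ys n)" "L2_fun y" "L2_limit ys y"
  shows "(\<lambda>n. \<integral>\<^sup>+t. ennreal (cmod (antidual_apply (ys n t) (us n t) - antidual_apply (y t) (u t)))
      \<partial>lebesgue_on {0..}) \<longlonglongrightarrow> 0"
proof -
  define N where "N = lebesgue_on {0::real..}"
  have sm: "strongly_measurable N u" "strongly_measurable N y"
      "strongly_measurable N (\<lambda>t. us n t - u t)" "strongly_measurable N (\<lambda>t. ys n t - y t)" for n
    using us ys by (simp_all add: L2_fun_def N_def strongly_measurable_diff)
  \<comment> \<open>Finiteness excludes a limit of the form 0 times infinity, where multiplication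
    is discontinuous.\<close>
  have fin: "L2_sqnorm u \<noteq> \<infinity>" "L2_sqnorm y \<noteq> \<infinity>"
    using us ys by (auto simp: L2_fun_def)
  have lim: "(\<lambda>n. L2_sqnorm (\<lambda>t. us n t - u t)) \<longlonglongrightarrow> 0" "(\<lambda>n. L2_sqnorm (\<lambda>t. ys n t - y t)) \<longlonglongrightarrow> 0"
    using us ys by (simp_all add: L2_limit_def)
  define I where "I f g = (\<integral>\<^sup>+t. ennreal (cmod (antidual_apply (f t) (g t))) \<partial>N)"
    for f :: "real \<Rightarrow> 'b antidual" and g
  have I_le: "(I f g)\<^sup>2 \<le> L2_sqnorm f * L2_sqnorm g"
    if "strongly_measurable N f" "strongly_measurable N g" for f :: "real \<Rightarrow> 'b antidual" and g
    using that unfolding I_def N_def by (rule nn_integral_antidual_apply_le)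
  have I1: "(\<lambda>n. I (\<lambda>t. ys n t - y t) (\<lambda>t. us n t - u t)) \<longlonglongrightarrow> 0"
    by (rule ennreal_tendsto_zero_of_square[where b = "\<lambda>n. L2_sqnorm (\<lambda>t. ys n t - y t) * L2_sqnorm (\<lambda>t. us n t - u t)"], rule I_le[OF sm(4) sm(3)])
      (use tendsto_mult_ennreal[OF lim(2) lim(1)] in simp)
  have I2: "(\<lambda>n. I (\<lambda>t. ys n t - y t) u) \<longlonglongrightarrow> 0"
    by (rule ennreal_tendsto_zero_of_square[where b = "\<lambda>n. L2_sqnorm (\<lambda>t. ys n t - y t) * L2_sqnorm u"], rule I_le[OF sm(4) sm(1)])
      (use tendsto_mult_ennreal[OF lim(2) tendsto_const[of "L2_sqnorm u"]] fin in simp)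
  have I3: "(\<lambda>n. I y (\<lambda>t. us n t - u t)) \<longlonglongrightarrow> 0"
    by (rule ennreal_tendsto_zero_of_square[where b = "\<lambda>n. L2_sqnorm y * L2_sqnorm (\<lambda>t. us n t - u t)"], rule I_le[OF sm(2) sm(3)])
      (use tendsto_mult_ennreal[OF tendsto_const[of "L2_sqnorm y"] lim(1)] fin in simp)
  have meas: "(\<lambda>t. antidual_apply (f t) (g t)) \<in> borel_measurable N"
    if "strongly_measurable N f" "strongly_measurable N g" for f :: "real \<Rightarrow> 'b antidual" and g
    using that unfolding N_def by (intro borel_measurable_antidual_apply) simp_all
  \<comment> \<open>Measurability is what allows the integral of the sum to be split.\<close>
  have [measurable]: "(\<lambda>t. antidual_apply (ys n t - y t) (us n t - u t)) \<in> borel_measurable N"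
    "(\<lambda>t. antidual_apply (ys n t - y t) (u t)) \<in> borel_measurable N"
    "(\<lambda>t. antidual_apply (y t) (us n t - u t)) \<in> borel_measurable N" for n
    by (intro meas sm)+
  have le: "(\<integral>\<^sup>+t. ennreal (cmod (antidual_apply (ys n t) (us n t) - antidual_apply (y t) (u t))) \<partial>N)
      \<le> I (\<lambda>t. ys n t - y t) (\<lambda>t. us n t - u t) + I (\<lambda>t. ys n t - y t) u + I y (\<lambda>t. us n t - u t)"
    (is "?L n \<le> ?R n") for n
  proof -
    have "?L n \<le> (\<integral>\<^sup>+t. ennreal (cmod (antidual_apply (ys n t - y t) (us n t - u t)))
        + ennreal (cmod (antidual_apply (ys n t - y t) (u t)))
        + ennreal (cmod (antidual_apply (y t) (us n t - u t))) \<partial>N)"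
    proof (rule nn_integral_mono)
      fix t
      define a b c where "a = antidual_apply (ys n t - y t) (us n t - u t)"
        and "b = antidual_apply (ys n t - y t) (u t)" and "c = antidual_apply (y t) (us n t - u t)"
      have "antidual_apply (ys n t) (us n t) - antidual_apply (y t) (u t) = a + b + c"
        by (simp add: a_def b_def c_def bounded_bilinear.diff_left[OF bounded_bilinear_antidual_apply]
            bounded_bilinear.diff_right[OF bounded_bilinear_antidual_apply])
      moreover have "cmod (a + b + c) \<le> cmod a + cmod b + cmod c"
        by (rule order_trans[OF norm_triangle_ineq add_right_mono[OF norm_triangle_ineq]])
      ultimately show "ennreal (cmod (antidual_apply (ys n t) (us n t) - antidual_apply (y t) (u t)))
          \<le> ennreal (cmod a) + ennreal (cmod b) + ennreal (cmod c)"
        by (simp add: ennreal_plus[symmetric] del: ennreal_plus)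
    qed
    also have "\<dots> = ?R n" by (simp add: I_def nn_integral_add)
    finally show ?thesis .
  qed
  have R: "?R \<longlonglongrightarrow> 0"
    using tendsto_add[OF tendsto_add[OF I1 I2] I3] by simp
  have "?L \<longlonglongrightarrow> 0"
    by (rule tendsto_sandwich[OF always_eventually always_eventually tendsto_const R]) (simp_all only: le zero_le simp_thms)
  then show ?thesis by (simp add: N_def)
qed

lemma set_integrable_antidual_apply:
  fixes u :: "real \<Rightarrow> 'b::complex_normed_vector"
  assumes u: "L2_fun u" and y: "L2_fun y"
  shows "set_integrable lebesgue {0..} (\<lambda>t. antidual_apply (y t) (u t))"
proof -
  have "(\<integral>\<^sup>+t. ennreal (cmod (antidual_apply (y t) (u t))) \<partial>lebesgue_on {0..})\<^sup>2 \<le> L2_sqnorm y * L2_sqnorm u"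
    using u y by (intro nn_integral_antidual_apply_le) (simp_all add: L2_fun_def)
  also have "\<dots> < \<infinity>" using u y by (simp add: L2_fun_def ennreal_mult_less_top)
  finally have "(\<integral>\<^sup>+t. ennreal (cmod (antidual_apply (y t) (u t))) \<partial>lebesgue_on {0..}) < \<infinity>"
    by (simp add: power_less_top_ennreal)
  moreover have "(\<lambda>t. antidual_apply (y t) (u t)) \<in> borel_measurable (lebesgue_on {0..})"
    using u y by (intro borel_measurable_antidual_apply) (simp_all add: L2_fun_def)
  ultimately have "integrable (lebesgue_on {0..}) (\<lambda>t. antidual_apply (y t) (u t))"
    by (simp add: integrable_iff_bounded)
  then show ?thesis
    by (simp add: set_integrable_def integrable_restrict_space)
qed

text \<open>The distance of the integrals over \<open>{0..t}\<close> is at most the integral of the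
  distance over the half-line, which tends to 0.\<close>

lemma set_integral_antidual_apply_tendsto:
  fixes us :: "nat \<Rightarrow> real \<Rightarrow> 'b::complex_normed_vector"
  assumes us: "\<And>n. L2_fun (us n)" "L2_fun u" "L2_limit us u"
    and ys: "\<And>n. L2_fun (ys n)" "L2_fun y" "L2_limit ys y"
  shows "(\<lambda>n. LINT s:{0..t}|lebesgue. antidual_apply (ys n s) (us n s))
    \<longlonglongrightarrow> (LINT s:{0..t}|lebesgue. antidual_apply (y s) (u s))"
proof -
  define p where "p n s = antidual_apply (ys n s) (us n s)" for n s
  define q where "q s = antidual_apply (y s) (u s)" for s
  have int: "set_integrable lebesgue {0..t} (p n)" "set_integrable lebesgue {0..t} q" for n
    unfolding p_def q_def
    using us ys by (auto intro: set_integrable_subset[OF set_integrable_antidual_apply])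
  have le: "ennreal (dist (LINT s:{0..t}|lebesgue. p n s) (LINT s:{0..t}|lebesgue. q s))
      \<le> (\<integral>\<^sup>+s. ennreal (cmod (p n s - q s)) \<partial>lebesgue_on {0..})" for n
  proof -
    have "ennreal (dist (LINT s:{0..t}|lebesgue. p n s) (LINT s:{0..t}|lebesgue. q s)) =
        ennreal (cmod (LINT s:{0..t}|lebesgue. p n s - q s))"
      using int by (simp add: dist_norm set_integral_diff)
    also have "\<dots> \<le> (\<integral>\<^sup>+s. ennreal (cmod (indicat_real {0..t} s *\<^sub>R (p n s - q s))) \<partial>lebesgue)"
      using set_integral_diff(1)[OF int, of n] unfolding set_lebesgue_integral_def set_integrable_def
      by (rule integral_norm_bound_ennreal)
    also have "\<dots> \<le> (\<integral>\<^sup>+s. ennreal (cmod (p n s - q s)) * indicator {0..} s \<partial>lebesgue)"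
      by (intro nn_integral_mono) (simp split: split_indicator)
    also have "\<dots> = (\<integral>\<^sup>+s. ennreal (cmod (p n s - q s)) \<partial>lebesgue_on {0..})"
      by (simp add: nn_integral_restrict_space)
    finally show ?thesis .
  qed
  have "(\<lambda>n. ennreal (dist (LINT s:{0..t}|lebesgue. p n s) (LINT s:{0..t}|lebesgue. q s))) \<longlonglongrightarrow> 0"
    by (rule tendsto_sandwich[OF always_eventually always_eventually tendsto_const
          nn_integral_antidual_apply_diff_tendsto[OF us ys, folded p_def q_def]])
      (simp_all only: le zero_le simp_thms)
  then have "(\<lambda>n. dist (LINT s:{0..t}|lebesgue. p n s) (LINT s:{0..t}|lebesgue. q s)) \<longlonglongrightarrow> 0"
    by (simp add: ennreal_0[symmetric] tendsto_ennreal_iff del: ennreal_0)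
  then show ?thesis
    unfolding p_def q_def by (rule tendsto_dist_iff[THEN iffD2])
qed

text \<open>The Hamiltonian is continuous and the states converge at the times 0 and
  \<open>t\<close>; the supplied energy converges as well, and the non-strict inequality survives
  the limit.\<close>

lemma generalized_trajectory_dissipation_inequality:
  assumes node: "port_hamiltonian_operator_node E Q M S"
    and traj: "generalized_trajectory E S x u w y"
  shows "dissipation_inequality (hamiltonian E Q) x u y"
  unfolding dissipation_inequality_def
proof (intro allI impI)
  fix t :: real assume t: "0 \<le> t"
  have E: "bounded_linear E" and Q: "bounded_linear Q"
    using node by (simp_all add: port_hamiltonian_operator_node_def bounded_clinear_def)
  obtain xs us ws ys
    where approx: "\<And>n. classical_trajectory E S (xs n) (us n) (ws n) (ys n) \<and> L2_fun (us n) \<and> L2_fun (ys n)"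
      and lims: "L2_limit us u" "L2_limit ys y" and xs: "C_limit xs x"
    using traj unfolding generalized_trajectory_def by blast
  have classical: "classical_trajectory E S (xs n) (us n) (ws n) (ys n)" for n
    using approx by blast
  have L2: "\<And>n. L2_fun (us n)" "L2_fun u" "L2_limit us u" "\<And>n. L2_fun (ys n)" "L2_fun y" "L2_limit ys y"
    using traj approx lims by (auto simp: generalized_trajectory_def)
  have lim: "(\<lambda>n. hamiltonian E Q (xs n s)) \<longlonglongrightarrow> hamiltonian E Q (x s)" if "s \<in> {0..t}" for s
  proof -
    have "(\<lambda>n. xs n s) \<longlonglongrightarrow> x s"
      using xs t that unfolding C_limit_def by (blast intro: tendsto_uniform_limitI)
    then show ?thesis
      unfolding hamiltonian_def
      by (intro tendsto_divide tendsto_Re tendsto_const bounded_bilinear.tendsto[OF bounded_bilinear_cinner]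
          bounded_linear.tendsto[OF E] bounded_linear.tendsto[OF Q]) simp_all
  qed
  show "hamiltonian E Q (x t) - hamiltonian E Q (x 0)
      \<le> Re (LINT s:{0..t}|lebesgue. antidual_apply (y s) (u s))"
  proof (rule LIMSEQ_le)
    show "(\<lambda>n. hamiltonian E Q (xs n t) - hamiltonian E Q (xs n 0))
        \<longlonglongrightarrow> hamiltonian E Q (x t) - hamiltonian E Q (x 0)"
      using t by (intro tendsto_diff lim) auto
    show "(\<lambda>n. Re (LINT s:{0..t}|lebesgue. antidual_apply (ys n s) (us n s)))
        \<longlonglongrightarrow> Re (LINT s:{0..t}|lebesgue. antidual_apply (y s) (u s))"
      by (intro tendsto_Re set_integral_antidual_apply_tendsto L2)
    show "\<exists>N. \<forall>n\<ge>N. hamiltonian E Q (xs n t) - hamiltonian E Q (xs n 0)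
        \<le> Re (LINT s:{0..t}|lebesgue. antidual_apply (ys n s) (us n s))"
      using classical_trajectory_dissipation_inequality[OF node classical] t
      by (simp add: dissipation_inequality_def)
  qed
qed


text \<open>A classical trajectory whose input or output is not square integrable on the half-line
  is not a generalized one, so the dissipation inequality is asserted for both kinds.\<close>

theorem theorem4p8:
  fixes D\<^sub>X :: "'x::chilbert_space set" and h\<^sub>X :: "'x \<Rightarrow> 'x \<Rightarrow> complex"
    and i\<^sub>X :: "'x \<Rightarrow> 'xh::chilbert_space" and j\<^sub>X :: "'x \<Rightarrow> 'xh antidual"
    and D\<^sub>Z :: "'z::chilbert_space set" and h\<^sub>Z :: "'z \<Rightarrow> 'z \<Rightarrow> complex"
    and i\<^sub>Z :: "'z \<Rightarrow> 'zh::chilbert_space" and j\<^sub>Z :: "'z \<Rightarrow> 'zh antidual"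
    and E Q :: "'xh \<Rightarrow> 'zh"
    and M :: "'zh antidual \<times> 'u::chilbert_space \<rightharpoonup> 'zh \<times> 'u antidual"
    and S :: "'xh \<times> 'u \<rightharpoonup> 'zh \<times> 'u antidual"
  assumes "quasi_gelfand_triple D\<^sub>X h\<^sub>X i\<^sub>X j\<^sub>X"
    and "quasi_gelfand_triple D\<^sub>Z h\<^sub>Z i\<^sub>Z j\<^sub>Z"
    and "port_hamiltonian_operator_node E Q M S"
  shows "(invertible_clinear Q \<and> closed (range E) \<longrightarrow>
      {l. Re l > 0} \<subseteq> resolvent_set E (main_operator M \<circ> riesz \<circ> Q) \<and>
      port_hamiltonian_system_node E Q M S \<and>
      complex_resolvent_index E (main_operator M \<circ> riesz \<circ> Q) \<le> 3)
    \<and> (\<forall>x u w y. generalized_trajectory E S x u w y \<longrightarrow>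
        dissipation_inequality (hamiltonian E Q) x u y)
    \<and> (\<forall>x u w y. classical_trajectory E S x u w y \<longrightarrow>
        dissipation_inequality (hamiltonian E Q) x u y)"
  using port_hamiltonian_resolvent(1) port_hamiltonian_system_nodeI port_hamiltonian_resolvent_index
    generalized_trajectory_dissipation_inequality classical_trajectory_dissipation_inequality assms(3)
  by (intro conjI impI allI) blast+

end
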